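(* Let $\theta=(\{\theta_s\}_{s\in S},\{X_s\}_{s\in S})$ be an action of an inverse semigroup $S$ on a locally compact, Hausdorff, zero-dimensional space $X$, and let $\mathcal O$ be an $S\ltimes X$-sheaf of rings. If $\Gamma_c(S\ltimes X,\mathcal O)$ is left primitive, then $\theta$ has a dense orbit.
   Context: "Compact" includes Hausdorff. Zero-dimensional: having a basis of compact open sets. An action $\theta$ of an inverse semigroup $S$ on $X$ is a semigroup homomorphism $s\mapsto\theta_s$ to the inverse semigroup of homeomorphisms between open subsets of $X$, where $\theta_s:X_{s^*}\to X_s$, and such that $\bigcup_{s\in S}X_s=X$. The orbit of $x$ is $\{\theta_s(x): s\in S,\ x\in X_{s^*}\}$. Groupoid of germs $S\ltimes X$: unit space $X$; arrows are classes $[s,x]$ of pairs $(s,x)\in S\times X$ with $x\in X_{s^*}$, where $(s,x)\sim(t,y)$ iff $x=y$ and there is $u\le s,t$ with $x\in X_{u^*}$; $\boldsymbol d([s,x])=x$, $\boldsymbol r([s,x])=\theta_s(x)$, $[s,\theta_t(x)][t,x]=[st,x]$, $[s,x]^{-1}=[s^*,\theta_s(x)]$; basic open sets $(s,U)=\{[s,x]:x\in U\}$ for $U\subseteq X_{s^*}$ open. It is an ample groupoid: a topological groupoid with locally compact Hausdorff unit space having a basis of compact open sets and with $\boldsymbol r$ a local homeomorphism. For an ample groupoid $\mathscr G$: a bisection is a subset on which $\boldsymbol d$ and $\boldsymbol r$ are injective. A $\mathscr G$-sheaf $(E,p,\alpha)$ is a space $E$, a local homeomorphism $p:E\to\mathscr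 G^{(0)}$ and a continuous map $\alpha:\mathscr G\times_{\boldsymbol d,p}E\to E$, $(\gamma,e)\mapsto\alpha_\gamma(e)$, with $\alpha_{p(e)}(e)=e$, $p(\alpha_\gamma(e))=\boldsymbol r(\gamma)$, and $\alpha_\beta(\alpha_\gamma(e))=\alpha_{\beta\gamma}(e)$ whenever defined. A $\mathscr G$-sheaf of rings $\mathcal O=(E,p,\alpha)$ is a $\mathscr G$-sheaf with a unital ring structure on each stalk $\mathcal O_x=p^{-1}(x)$ such that fiberwise addition and multiplication $E\times_{p,p}E\to E$ and the unit section $x\mapsto1_x$ are continuous, and each $\alpha_\gamma:\mathcal O_{\boldsymbol d(\gamma)}\to\mathcal O_{\boldsymbol r(\gamma)}$ is a ring homomorphism. $\Gamma_c(\mathscr G,\mathcal O)$ is the additive group generated by all maps $f:\mathscr G\to E$ with $p\circ f=\boldsymbol r$ for which there is a compact open bisection $U$ with $f|_U$ continuous and $f=0$ off $U$; it is a ring under pointwise addition and convolution $(f*g)(\gamma)=\sum_{\beta\rho=\gamma}f(\beta)\alpha_\beta(g(\rho))$. A ring $R$ is left primitive if it has a faithful simple left module; a simple left $R$-module is a module $N$ with $RN\neq 0$ whose only submodules are $0$ and $N$.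
   Formalization: The stalks of the sheaf of rings are required to be nonzero unital rings (1 ≠ 0 in every stalk); with zero stalks the claim fails, e.g. on a two-point discrete space with trivial action and stalks a field and 0. *)

theory Defs
  imports
    "HOL-Analysis.Abstract_Topological_Spaces"
    "HOL-Analysis.Function_Topology"
    "HOL-Algebra.Module"
    "HOL-Algebra.Product_Groups"
begin

section \<open>Topological preliminaries\<close>

text \<open>The library predicate \<open>compactin\<close> does not include the Hausdorff property. The distinction
  matters because the arrow space of a groupoid of germs need not be Hausdorff.\<close>

definition compact_Hausdorff_in :: "'a topology \<Rightarrow> 'a set \<Rightarrow> bool" where
  "compact_Hausdorff_in X K \<longleftrightarrow> compactin X K \<and> Hausdorff_space (subtopology X K)"

definition zero_dimensional_space :: "'a topology \<Rightarrow> bool" where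
  "zero_dimensional_space X \<longleftrightarrow>
     (\<exists>B. (\<forall>V\<in>B. openin X V \<and> compact_Hausdorff_in X V) \<and>
          (\<forall>U x. openin X U \<and> x \<in> U \<longrightarrow> (\<exists>V\<in>B. x \<in> V \<and> V \<subseteq> U)))"

definition local_homeomorphism :: "'a topology \<Rightarrow> 'b topology \<Rightarrow> ('a \<Rightarrow> 'b) \<Rightarrow> bool" where
  "local_homeomorphism E X p \<longleftrightarrow>
     (\<forall>e \<in> topspace E. \<exists>U. openin E U \<and> e \<in> U \<and> openin X (p ` U) \<and>
        homeomorphic_map (subtopology E U) (subtopology X (p ` U)) p)"

section \<open>Inverse semigroups and their actions\<close>

class inverse_semigroup = semigroup_mult +
  assumes ex1_inverse: "\<exists>!t. s * t * s = s \<and> t * s * t = t"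

definition star :: "'s::inverse_semigroup \<Rightarrow> 's" where
  "star s = (THE t. s * t * s = s \<and> t * s * t = t)"

definition idem :: "'s::inverse_semigroup \<Rightarrow> bool" where
  "idem e \<longleftrightarrow> e * e = e"

text \<open>The natural partial order.\<close>

definition nat_le :: "'s::inverse_semigroup \<Rightarrow> 's \<Rightarrow> bool" where
  "nat_le s t \<longleftrightarrow> (\<exists>e. idem e \<and> s = t * e)"

text \<open>\<open>D s\<close> is the open set \<open>X\<^sub>s\<close>. The total function \<open>\<theta> s\<close> matters only on its domain
  \<open>D (star s)\<close>. The assumptions \<open>comp_dom\<close> and \<open>comp_eq\<close> say that \<open>\<theta>\<^sub>s \<circ> \<theta>\<^sub>t = \<theta>\<^bsub>st\<^esub>\<close> as partial
  maps, with equality of domains.\<close>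

locale inverse_semigroup_action =
  fixes X :: "'x topology"
    and D :: "'s::inverse_semigroup \<Rightarrow> 'x set"
    and \<theta> :: "'s \<Rightarrow> 'x \<Rightarrow> 'x"
  assumes open_D: "openin X (D s)"
    and homeo: "homeomorphic_map (subtopology X (D (star s))) (subtopology X (D s)) (\<theta> s)"
    and comp_dom: "{x \<in> D (star t). \<theta> t x \<in> D (star s)} = D (star (s * t))"
    and comp_eq: "\<lbrakk>x \<in> D (star t); \<theta> t x \<in> D (star s)\<rbrakk> \<Longrightarrow> \<theta> (s * t) x = \<theta> s (\<theta> t x)"
    and covers: "(\<Union>s. D s) = topspace X"

definition action_orbit ::
    "('s::inverse_semigroup \<Rightarrow> 'x set) \<Rightarrow> ('s \<Rightarrow> 'x \<Rightarrow> 'x) \<Rightarrow> 'x \<Rightarrow> 'x set" where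
  "action_orbit D \<theta> x = {\<theta> s x | s. x \<in> D (star s)}"

section \<open>Groupoids of germs\<close>

text \<open>The unit space is a space of its own, embedded in the arrows by \<open>gunit\<close>, so that the unit
  space of a groupoid of germs is literally \<open>X\<close>. The product \<open>gmult G \<beta> \<gamma>\<close> is meaningful only
  if \<open>gd G \<beta> = gr G \<gamma>\<close>.\<close>

record ('g, 'x) top_groupoid =
  arrows :: "'g topology"
  units :: "'x topology"
  gd :: "'g \<Rightarrow> 'x"
  gr :: "'g \<Rightarrow> 'x"
  gmult :: "'g \<Rightarrow> 'g \<Rightarrow> 'g"
  gunit :: "'x \<Rightarrow> 'g"
  ginv :: "'g \<Rightarrow> 'g"

definition germ_rel :: "('s::inverse_semigroup \<Rightarrow> 'x set) \<Rightarrow> (('s \<times> 'x) \<times> ('s \<times> 'x)) set" where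
  "germ_rel D = {((s, x), (t, y)). x \<in> D (star s) \<and> y \<in> D (star t) \<and> x = y \<and>
     (\<exists>u. nat_le u s \<and> nat_le u t \<and> x \<in> D (star u))}"

definition germ :: "('s::inverse_semigroup \<Rightarrow> 'x set) \<Rightarrow> 's \<Rightarrow> 'x \<Rightarrow> ('s \<times> 'x) set" where
  "germ D s x = germ_rel D `` {(s, x)}"

text \<open>The structure maps are defined on classes by ranging over all representatives; that they
  are given by the usual formulas is shown below. The unit at \<open>x\<close> is the class of \<open>(e, x)\<close> for any
  idempotent \<open>e\<close> with \<open>x\<close> in \<open>X\<^sub>e\<close>.\<close>

definition germ_groupoid ::
    "'x topology \<Rightarrow> ('s::inverse_semigroup \<Rightarrow> 'x set) \<Rightarrow> ('s \<Rightarrow> 'x \<Rightarrow> 'x) \<Rightarrow>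
     (('s \<times> 'x) set, 'x) top_groupoid" where
  "germ_groupoid X D \<theta> = \<lparr>
     arrows = topology_generated_by {germ D s ` U | s U. openin X U \<and> U \<subseteq> D (star s)},
     units = X,
     gd = (\<lambda>\<gamma>. the_elem (snd ` \<gamma>)),
     gr = (\<lambda>\<gamma>. the_elem ((\<lambda>(s, x). \<theta> s x) ` \<gamma>)),
     gmult = (\<lambda>\<beta> \<gamma>. \<Union>(s, y)\<in>\<beta>. \<Union>(t, x)\<in>\<gamma>. germ D (s * t) x),
     gunit = (\<lambda>x. \<Union>e\<in>{e. idem e \<and> x \<in> D e}. germ D e x),
     ginv = (\<lambda>\<gamma>. \<Union>(s, x)\<in>\<gamma>. germ D (star s) (\<theta> s x))\<rparr>"

lemma star_inverse: "s * star s * s = (s :: 's::inverse_semigroup)" "star s * s * star s = star s"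
  using theI'[OF ex1_inverse[of s]] unfolding star_def by auto

lemma star_unique: "\<lbrakk>s * t * s = s; t * s * t = t\<rbrakk> \<Longrightarrow> t = star (s :: 's::inverse_semigroup)"
  using ex1_inverse[of s] star_inverse by metis

lemma star_idem: "idem e \<Longrightarrow> star e = e"
  by (metis idem_def star_unique)

lemma star_star [simp]: "star (star s) = s"
  by (metis star_inverse star_unique)

lemma idem_mult:
  assumes e: "idem e" and f: "idem f"
  shows "idem (e * f)"
proof -
  let ?g = "f * star (e * f) * e"
  have ee: "e * e = e" and ff: "f * f = f"
    using e f by (auto simp: idem_def)
  have ee': "e * (e * z) = e * z" and ff': "f * (f * z) = f * z" for z
    by (metis ee mult.assoc) (metis ff mult.assoc)
  have 1: "e * f * star (e * f) * (e * f) = e * f" "star (e * f) * (e * f) * star (e * f) = star (e * f)"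
    by (rule star_inverse)+
  have 2: "e * (f * (star (e * f) * (e * (f * z)))) = e * (f * z)" for z
    using arg_cong[OF 1(1), of "\<lambda>t. t * z"] by (simp add: mult.assoc)
  have 3: "star (e * f) * (e * (f * (star (e * f) * z))) = star (e * f) * z" for z
    using arg_cong[OF 1(2), of "\<lambda>t. t * z"] by (simp add: mult.assoc)
  have "e * f * ?g * (e * f) = e * f"
    using 1(1) by (simp add: mult.assoc ee' ff')
  moreover have "?g * (e * f) * ?g = ?g"
    by (simp add: mult.assoc ee' ff' 3)
  ultimately have g: "?g = star (e * f)"
    by (rule star_unique)
  have "idem ?g"
    unfolding idem_def by (simp add: mult.assoc 3)
  then have "idem (star (e * f))"
    using g by simp
  then show ?thesis
    by (metis star_idem star_star)
qed

lemma idem_commute: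
  assumes e: "idem e" and f: "idem f"
  shows "e * f = f * e"
proof -
  have ee: "e * (e * z) = e * z" and ff: "f * (f * z) = f * z" for z
    using e f by (metis idem_def mult.assoc)+
  have ef: "(e * f) * (e * f) = e * f" "(f * e) * (f * e) = f * e"
    using idem_mult e f by (auto simp: idem_def)
  have "f * e = star (e * f)"
    by (rule star_unique) (use ef in \<open>simp_all add: mult.assoc ee ff\<close>)
  also have "\<dots> = e * f"
    by (rule star_idem) (rule idem_mult[OF e f])
  finally show ?thesis by simp
qed

lemma idem_star_mult: "idem (star s * s)" "idem (s * star s)"
  unfolding idem_def by (metis mult.assoc star_inverse)+

lemma idem_conj:
  assumes "idem e"
  shows "idem (star t * e * t)" "e * t = t * (star t * e * t)"
proof -
  have "e * (t * star t) = t * star t * e"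
    using assms idem_commute idem_star_mult by blast
  then show 2: "e * t = t * (star t * e * t)"
    by (metis mult.assoc star_inverse(1))
  show "idem (star t * e * t)"
    using assms 2 unfolding idem_def by (metis mult.assoc)
qed

lemma nat_le_refl: "nat_le s s"
  unfolding nat_le_def by (metis idem_star_mult(1) mult.assoc star_inverse(1))

lemma nat_le_mult:
  assumes "nat_le u s" "nat_le v t"
  shows "nat_le (u * v) (s * t)"
proof -
  obtain e f where e: "idem e" "u = s * e" and f: "idem f" "v = t * f"
    using assms by (auto simp: nat_le_def)
  have "u * v = s * (e * t) * f"
    using e f by (simp add: mult.assoc)
  also have "\<dots> = s * (t * (star t * e * t)) * f"
    using idem_conj(2)[OF e(1), of t] by simp
  also have "\<dots> = (s * t) * ((star t * e * t) * f)"
    by (simp add: mult.assoc)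
  finally show ?thesis
    using idem_mult[OF idem_conj(1)[OF e(1)] f(1)] by (auto simp: nat_le_def)
qed

lemma star_mult: "star (s * t) = star t * star (s :: 's::inverse_semigroup)"
proof (rule star_unique[symmetric])
  have c: "(t * star t) * (star s * s) = (star s * s) * (t * star t)"
    by (intro idem_commute idem_star_mult)
  have "s * t * (star t * star s) * (s * t) = s * ((t * star t) * (star s * s)) * t"
    by (simp add: mult.assoc)
  also have "\<dots> = (s * star s * s) * (t * star t * t)"
    unfolding c by (simp add: mult.assoc)
  finally show "s * t * (star t * star s) * (s * t) = s * t"
    by (simp add: star_inverse)
  have "star t * star s * (s * t) * (star t * star s) = star t * ((star s * s) * (t * star t)) * star s"
    by (simp add: mult.assoc)
  also have "\<dots> = (star t * t * star t) * (star s * s * star s)"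
    unfolding c[symmetric] by (simp add: mult.assoc)
  finally show "star t * star s * (s * t) * (star t * star s) = star t * star s"
    by (simp add: star_inverse)
qed

lemma nat_le_star:
  assumes "nat_le u s"
  shows "nat_le (star u) (star s)"
proof -
  obtain e where e: "idem e" "u = s * e"
    using assms by (auto simp: nat_le_def)
  then have "star u = e * star s"
    by (simp add: star_mult star_idem)
  also have "\<dots> = star s * (star (star s) * e * star s)"
    by (rule idem_conj(2)[OF e(1)])
  finally show ?thesis
    unfolding nat_le_def using idem_conj(1)[OF e(1)] by blast
qed

lemma nat_le_mult_idem: "\<lbrakk>nat_le u s; idem f\<rbrakk> \<Longrightarrow> nat_le (u * f) s"
  unfolding nat_le_def by (metis idem_mult mult.assoc)

context inverse_semigroup_action
begin

lemma D_sub: "D s \<subseteq> topspace X"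
  using open_D by (simp add: openin_subset)

lemma dom_mult_iff: "x \<in> D (star (s * t)) \<longleftrightarrow> x \<in> D (star t) \<and> \<theta> t x \<in> D (star s)"
  using comp_dom[of t s] by blast

lemma theta_image: "\<theta> s ` D (star s) = D s"
  using homeomorphic_imp_surjective_map[OF homeo[of s]] D_sub by (simp add: Int_absorb1)

lemma theta_inj: "inj_on (\<theta> s) (D (star s))"
  using homeomorphic_imp_injective_map[OF homeo[of s]] D_sub by (simp add: Int_absorb1)

lemma theta_idem:
  assumes "idem e" "x \<in> D e"
  shows "\<theta> e x = x"
proof -
  have e: "star e = e" "e * e = e"
    using assms by (auto simp: star_idem idem_def)
  have x: "\<theta> e x \<in> D e"
    using theta_image[of e] e assms(2) by auto
  then have "\<theta> e (\<theta> e x) = \<theta> e x"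
    using comp_eq[of x e e] e assms(2) by simp
  then show ?thesis
    using theta_inj[of e] e x assms(2) by (auto simp: inj_on_def)
qed

lemma theta_le:
  assumes "nat_le u s" "x \<in> D (star u)"
  shows "x \<in> D (star s)" "\<theta> u x = \<theta> s x"
proof -
  obtain e where e: "idem e" "u = s * e"
    using assms by (auto simp: nat_le_def)
  then have x: "x \<in> D e" "\<theta> e x \<in> D (star s)"
    using assms(2) by (simp_all add: dom_mult_iff star_idem)
  then show "x \<in> D (star s)"
    using theta_idem e by simp
  show "\<theta> u x = \<theta> s x"
    using comp_eq[of x e s] x e theta_idem[OF e(1)] by (simp add: star_idem)
qed

lemma theta_star:
  assumes "x \<in> D (star s)"
  shows "\<theta> s x \<in> D s" "\<theta> (star s) (\<theta> s x) = x"
proof -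
  show *: "\<theta> s x \<in> D s"
    using theta_image assms by blast
  then have "x \<in> D (star (star s * s))"
    using assms by (simp add: dom_mult_iff)
  then have "\<theta> (star s * s) x = x"
    by (metis idem_star_mult(1) star_idem theta_idem)
  then show "\<theta> (star s) (\<theta> s x) = x"
    using comp_eq[of x s "star s"] * assms by simp
qed

lemma equiv_germ_rel: "equiv {(s, x). x \<in> D (star s)} (germ_rel D)"
proof (rule equivI)
  show "germ_rel D \<subseteq> {(s, x). x \<in> D (star s)} \<times> {(s, x). x \<in> D (star s)}"
    by (auto simp: germ_rel_def)
  show "refl_on {(s, x). x \<in> D (star s)} (germ_rel D)"
    by (auto simp: refl_on_def germ_rel_def intro: nat_le_refl)
  show "sym (germ_rel D)"
    by (auto simp: sym_def germ_rel_def)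
  show "trans (germ_rel D)"
  proof (rule transI; clarsimp simp: germ_rel_def)
    fix s t w x u v
    assume u: "nat_le u s" "nat_le u t" "x \<in> D (star u)" and v: "nat_le v t" "nat_le v w" "x \<in> D (star v)"
    obtain e f where e: "idem e" "u = t * e" and f: "idem f" "v = t * f"
      using u v by (auto simp: nat_le_def)
    have "nat_le (u * f) s"
      using u(1) f(1) by (rule nat_le_mult_idem)
    moreover have "u * f = v * e"
      using e(2) f(2) idem_commute[OF e(1) f(1)] by (simp add: mult.assoc)
    then have "nat_le (u * f) w"
      using nat_le_mult_idem[OF v(2) e(1)] by simp
    moreover have "x \<in> D f"
      using v(3) f by (simp add: dom_mult_iff star_idem)
    then have "x \<in> D (star (u * f))"
      using u(3) f(1) theta_idem[OF f(1)] by (simp add: dom_mult_iff star_idem)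
    ultimately show "\<exists>u. nat_le u s \<and> nat_le u w \<and> x \<in> D (star u)"
      by blast
  qed
qed

lemma germ_eq:
  "\<lbrakk>x \<in> D (star s); y \<in> D (star t)\<rbrakk> \<Longrightarrow>
    germ D s x = germ D t y \<longleftrightarrow>
      x = y \<and> (\<exists>u. nat_le u s \<and> nat_le u t \<and> x \<in> D (star u))"
  unfolding germ_def by (subst eq_equiv_class_iff[OF equiv_germ_rel]) (auto simp: germ_rel_def)

lemma germ_self: "x \<in> D (star s) \<Longrightarrow> (s, x) \<in> germ D s x"
  by (auto simp: germ_def germ_rel_def intro: nat_le_refl)

lemma germ_memD:
  assumes "(t, y) \<in> germ D s x"
  shows "x \<in> D (star s)" "y \<in> D (star t)" "y = x" "\<theta> t y = \<theta> s x" "germ D t y = germ D s x"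
    "\<exists>u. nat_le u s \<and> nat_le u t \<and> x \<in> D (star u)"
proof -
  show x: "x \<in> D (star s)" and t: "y \<in> D (star t)" and y: "y = x"
    and u: "\<exists>u. nat_le u s \<and> nat_le u t \<and> x \<in> D (star u)"
    using assms by (auto simp: germ_def germ_rel_def)
  show "\<theta> t y = \<theta> s x"
    using u y theta_le(2) by metis
  show "germ D t y = germ D s x"
    using germ_eq[OF t x] u y by blast
qed

lemma gd_germ: "x \<in> D (star s) \<Longrightarrow> gd (germ_groupoid X D \<theta>) (germ D s x) = x"
proof -
  assume x: "x \<in> D (star s)"
  have "snd q = x" if "q \<in> germ D s x" for q
    using germ_memD(3)[of "fst q" "snd q"] that by simp
  then have "snd ` germ D s x = {x}"
    using germ_self[OF x] by (auto intro: rev_image_eqI)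
  then show ?thesis
    by (simp add: germ_groupoid_def)
qed

lemma gr_germ: "x \<in> D (star s) \<Longrightarrow> gr (germ_groupoid X D \<theta>) (germ D s x) = \<theta> s x"
proof -
  assume x: "x \<in> D (star s)"
  have "(\<lambda>(s, x). \<theta> s x) q = \<theta> s x" if "q \<in> germ D s x" for q
    using germ_memD(4)[of "fst q" "snd q"] that by (simp add: case_prod_beta)
  then have "(\<lambda>(s, x). \<theta> s x) ` germ D s x = {\<theta> s x}"
    using germ_self[OF x] by (auto intro: rev_image_eqI)
  then show ?thesis
    by (simp add: germ_groupoid_def)
qed

lemma gmult_germ:
  assumes x: "x \<in> D (star t)" and y: "\<theta> t x \<in> D (star s)"
  shows "gmult (germ_groupoid X D \<theta>) (germ D s (\<theta> t x)) (germ D t x) = germ D (s * t) x"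
proof -
  have "germ D (s' * t') x' = germ D (s * t) x"
    if s': "(s', y') \<in> germ D s (\<theta> t x)" and t': "(t', x') \<in> germ D t x" for s' t' x' y'
  proof -
    note S = germ_memD[OF s'] and T = germ_memD[OF t']
    obtain u where u: "nat_le u s" "nat_le u s'" "\<theta> t x \<in> D (star u)"
      using S by blast
    obtain v where v: "nat_le v t" "nat_le v t'" "x \<in> D (star v)"
      using T by blast
    have "x \<in> D (star (u * v))"
      using u(3) v(3) theta_le(2)[OF v(1,3)] by (simp add: dom_mult_iff)
    moreover have "x \<in> D (star (s * t))" "x \<in> D (star (s' * t'))"
      using x y S(2,3) T(2,3,4) by (simp_all add: dom_mult_iff)
    moreover have "nat_le (u * v) (s * t)" "nat_le (u * v) (s' * t')"
      using u v by (blast intro: nat_le_mult)+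
    ultimately have "germ D (s' * t') x = germ D (s * t) x"
      using germ_eq[of x "s' * t'" x "s * t"] by blast
    then show ?thesis
      using T(3) by simp
  qed
  then have "(\<Union>(s', y')\<in>germ D s (\<theta> t x). \<Union>(t', x')\<in>germ D t x. germ D (s' * t') x') =
      (\<Union>q\<in>germ D s (\<theta> t x). \<Union>q'\<in>germ D t x. germ D (s * t) x)"
    by (intro SUP_cong refl) auto
  also have "\<dots> = germ D (s * t) x"
    using germ_self[OF x] germ_self[OF y] by blast
  finally have "(\<Union>(s', y')\<in>germ D s (\<theta> t x). \<Union>(t', x')\<in>germ D t x. germ D (s' * t') x') = germ D (s * t) x" .
  then show ?thesis
    by (simp add: germ_groupoid_def)
qed

lemma ginv_germ:
  assumes x: "x \<in> D (star s)"
  shows "ginv (germ_groupoid X D \<theta>) (germ D s x) = germ D (star s) (\<theta> s x)"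
proof -
  have "germ D (star t) (\<theta> t y) = germ D (star s) (\<theta> s x)" if t: "(t, y) \<in> germ D s x" for t y
  proof -
    note T = germ_memD[OF t]
    obtain u where u: "nat_le u s" "nat_le u t" "x \<in> D (star u)"
      using T by blast
    have "\<theta> s x \<in> D u"
      using theta_star(1)[OF u(3)] theta_le(2)[OF u(1,3)] by simp
    then show ?thesis
      using germ_eq[of "\<theta> t y" "star t" "\<theta> s x" "star s"] nat_le_star[OF u(1)] nat_le_star[OF u(2)]
        T(4) theta_star(1)[OF T(1)] theta_star(1)[OF T(2)]
      by auto
  qed
  then have "(\<Union>(t, y)\<in>germ D s x. germ D (star t) (\<theta> t y)) =
      (\<Union>q\<in>germ D s x. germ D (star s) (\<theta> s x))"
    by (intro SUP_cong refl) auto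
  also have "\<dots> = germ D (star s) (\<theta> s x)"
    using germ_self[OF x] by blast
  finally have "(\<Union>(t, y)\<in>germ D s x. germ D (star t) (\<theta> t y)) = germ D (star s) (\<theta> s x)" .
  then show ?thesis
    by (simp add: germ_groupoid_def)
qed

lemma gunit_germ:
  assumes e: "idem e" "x \<in> D e"
  shows "gunit (germ_groupoid X D \<theta>) x = germ D e x"
proof -
  have "germ D f x = germ D e x" if f: "idem f" "x \<in> D f" for f
  proof -
    have "nat_le (f * e) f" "nat_le (f * e) e"
      using nat_le_mult_idem[OF nat_le_refl e(1), of f] nat_le_mult_idem[OF nat_le_refl f(1), of e]
      unfolding idem_commute[OF e(1) f(1)] by blast+
    moreover have "x \<in> D (star (f * e))"
      unfolding dom_mult_iff theta_idem[OF e] star_idem[OF e(1)] star_idem[OF f(1)]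
      using e(2) f(2) by blast
    ultimately show ?thesis
      using germ_eq[of x f x e] e f star_idem[OF e(1)] star_idem[OF f(1)] by auto
  qed
  then have "(\<Union>f\<in>{f. idem f \<and> x \<in> D f}. germ D f x) =
      (\<Union>f\<in>{f. idem f \<and> x \<in> D f}. germ D e x)"
    by (intro SUP_cong refl) blast
  also have "\<dots> = germ D e x"
    using e by blast
  finally have "(\<Union>f\<in>{f. idem f \<and> x \<in> D f}. germ D f x) = germ D e x" .
  then show ?thesis
    by (simp add: germ_groupoid_def)
qed

lemma topspace_germ_groupoid:
  "topspace (arrows (germ_groupoid X D \<theta>)) = {germ D s x | s x. x \<in> D (star s)}"
proof -
  have "\<Union> {germ D s ` U | s U. openin X U \<and> U \<subseteq> D (star s)} = {germ D s x | s x. x \<in> D (star s)}"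
  proof (intro equalityI subsetI)
    fix \<gamma> assume "\<gamma> \<in> {germ D s x | s x. x \<in> D (star s)}"
    then obtain s x where "x \<in> D (star s)" "\<gamma> = germ D s x"
      by blast
    then have "\<gamma> \<in> germ D s ` D (star s)" "openin X (D (star s))"
      using open_D by simp_all
    then show "\<gamma> \<in> \<Union> {germ D s ` U | s U. openin X U \<and> U \<subseteq> D (star s)}"
      by blast
  qed blast
  then show ?thesis
    by (simp add: germ_groupoid_def)
qed

text \<open>The sets generating the topology of the arrows form a basis.\<close>

lemma germ_basis_inter:
  assumes U: "openin X U" "U \<subseteq> D (star s)" and V: "openin X V" "V \<subseteq> D (star t)"
    and g: "\<gamma> \<in> germ D s ` U \<inter> germ D t ` V"
  obtains u W where "openin X W" "W \<subseteq> D (star u)" "\<gamma> \<in> germ D u ` W"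
    "germ D u ` W \<subseteq> germ D s ` U \<inter> germ D t ` V"
proof -
  obtain x where x: "x \<in> U" "x \<in> V" "\<gamma> = germ D s x" "germ D s x = germ D t x"
  proof -
    obtain x y where "x \<in> U" "\<gamma> = germ D s x" "y \<in> V" "\<gamma> = germ D t y"
      using g by blast
    moreover from this have "x = y"
      using germ_eq[of x s y t] U(2) V(2) by auto
    ultimately show ?thesis
      using that by simp
  qed
  then obtain u where u: "nat_le u s" "nat_le u t" "x \<in> D (star u)"
    using U(2) V(2) germ_eq[of x s x t] by (meson subsetD)
  have eq: "germ D u y = germ D s y" "germ D u y = germ D t y" if "y \<in> D (star u)" for y
    using germ_eq[of y u y s] germ_eq[of y u y t] theta_le(1)[OF u(1) that] theta_le(1)[OF u(2) that]
      u(1,2) that nat_le_refl[of u] by metis+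
  show ?thesis
  proof (rule that[of "D (star u) \<inter> U \<inter> V" u])
    show "openin X (D (star u) \<inter> U \<inter> V)"
      using open_D U(1) V(1) by (intro openin_Int)
    show "\<gamma> \<in> germ D u ` (D (star u) \<inter> U \<inter> V)"
      unfolding x(3) eq(1)[OF u(3), symmetric] using x(1,2) u(3) by blast
    show "germ D u ` (D (star u) \<inter> U \<inter> V) \<subseteq> germ D s ` U \<inter> germ D t ` V"
    proof
      fix \<delta> assume "\<delta> \<in> germ D u ` (D (star u) \<inter> U \<inter> V)"
      then obtain y where "y \<in> D (star u)" "y \<in> U" "y \<in> V" "\<delta> = germ D u y"
        by blast
      then show "\<delta> \<in> germ D s ` U \<inter> germ D t ` V"
        using eq[of y] by (metis IntI image_eqI)
    qed
  qed blast
qed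

end

section \<open>Sheaves of rings on a groupoid and their convolution rings\<close>

locale groupoid_sheaf =
  fixes G :: "('g, 'x) top_groupoid"
    and E :: "'e topology"
    and p :: "'e \<Rightarrow> 'x"
    and \<alpha> :: "'g \<Rightarrow> 'e \<Rightarrow> 'e"
  assumes proj_local_homeo: "local_homeomorphism E (units G) p"
    and act_continuous:
      "continuous_map
         (subtopology (prod_topology (arrows G) E) {(\<gamma>, e). gd G \<gamma> = p e}) E (\<lambda>(\<gamma>, e). \<alpha> \<gamma> e)"
    and act_unit: "e \<in> topspace E \<Longrightarrow> \<alpha> (gunit G (p e)) e = e"
    and proj_act: "\<lbrakk>\<gamma> \<in> topspace (arrows G); e \<in> topspace E; gd G \<gamma> = p e\<rbrakk> \<Longrightarrow> p (\<alpha> \<gamma> e) = gr G \<gamma>"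
    and act_act:
      "\<lbrakk>\<beta> \<in> topspace (arrows G); \<gamma> \<in> topspace (arrows G); e \<in> topspace E;
        gd G \<beta> = gr G \<gamma>; gd G \<gamma> = p e\<rbrakk> \<Longrightarrow> \<alpha> \<beta> (\<alpha> \<gamma> e) = \<alpha> (gmult G \<beta> \<gamma>) e"

text \<open>\<open>\<O> x\<close> is the stalk at \<open>x\<close>. Unital rings are taken to satisfy \<open>1 \<noteq> 0\<close>, which the
  library locale \<open>ring\<close> does not include: with zero stalks allowed, a sheaf on a two-point discrete
  space (trivial groupoid) with stalks a field and \<open>0\<close> has a primitive convolution ring.\<close>

locale groupoid_sheaf_of_rings = groupoid_sheaf G E p \<alpha>
  for G :: "('g, 'x) top_groupoid"
    and E :: "'e topology"
    and p :: "'e \<Rightarrow> 'x"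
    and \<alpha> :: "'g \<Rightarrow> 'e \<Rightarrow> 'e" +
  fixes \<O> :: "'x \<Rightarrow> 'e ring"
  assumes stalk_carrier: "x \<in> topspace (units G) \<Longrightarrow> carrier (\<O> x) = {e \<in> topspace E. p e = x}"
    and stalk_ring: "x \<in> topspace (units G) \<Longrightarrow> ring (\<O> x)"
    and stalk_one_neq_zero: "x \<in> topspace (units G) \<Longrightarrow> \<one>\<^bsub>\<O> x\<^esub> \<noteq> \<zero>\<^bsub>\<O> x\<^esub>"
    and add_continuous:
      "continuous_map (subtopology (prod_topology E E) {(a, b). p a = p b}) E
         (\<lambda>(a, b). a \<oplus>\<^bsub>\<O> (p a)\<^esub> b)"
    and mult_continuous:
      "continuous_map (subtopology (prod_topology E E) {(a, b). p a = p b}) E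
         (\<lambda>(a, b). a \<otimes>\<^bsub>\<O> (p a)\<^esub> b)"
    and one_continuous: "continuous_map (units G) E (\<lambda>x. \<one>\<^bsub>\<O> x\<^esub>)"
    and act_ring_hom: "\<gamma> \<in> topspace (arrows G) \<Longrightarrow> \<alpha> \<gamma> \<in> ring_hom (\<O> (gd G \<gamma>)) (\<O> (gr G \<gamma>))"

definition compact_open_bisection :: "('g, 'x) top_groupoid \<Rightarrow> 'g set \<Rightarrow> bool" where
  "compact_open_bisection G U \<longleftrightarrow>
     openin (arrows G) U \<and> compact_Hausdorff_in (arrows G) U \<and> inj_on (gd G) U \<and> inj_on (gr G) U"

text \<open>All maps \<open>f\<close> with \<open>p \<circ> f = r\<close>, as a group under pointwise addition; such a map is made
  total on the type by the library convention for dependent products.\<close>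

definition section_group ::
    "('g, 'x) top_groupoid \<Rightarrow> ('x \<Rightarrow> 'e ring) \<Rightarrow> ('g \<Rightarrow> 'e) monoid" where
  "section_group G \<O> = product_group (topspace (arrows G)) (\<lambda>\<gamma>. add_monoid (\<O> (gr G \<gamma>)))"

definition elementary_sections ::
    "('g, 'x) top_groupoid \<Rightarrow> 'e topology \<Rightarrow> ('x \<Rightarrow> 'e ring) \<Rightarrow> ('g \<Rightarrow> 'e) set" where
  "elementary_sections G E \<O> =
     {f \<in> carrier (section_group G \<O>). \<exists>U. compact_open_bisection G U \<and>
        continuous_map (subtopology (arrows G) U) E f \<and>
        (\<forall>\<gamma> \<in> topspace (arrows G) - U. f \<gamma> = \<zero>\<^bsub>\<O> (gr G \<gamma>)\<^esub>)}"

text \<open>A \<open>finsum\<close> over an infinite set is \<open>\<zero>\<close> by convention, so the sum is restricted to its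
  nonzero terms, of which there are finitely many for elements of the convolution ring.\<close>

definition convolution ::
    "('g, 'x) top_groupoid \<Rightarrow> ('g \<Rightarrow> 'e \<Rightarrow> 'e) \<Rightarrow> ('x \<Rightarrow> 'e ring) \<Rightarrow>
     ('g \<Rightarrow> 'e) \<Rightarrow> ('g \<Rightarrow> 'e) \<Rightarrow> 'g \<Rightarrow> 'e" where
  "convolution G \<alpha> \<O> f g = (\<lambda>\<gamma>\<in>topspace (arrows G).
     let F = (\<lambda>(\<beta>, \<rho>). f \<beta> \<otimes>\<^bsub>\<O> (gr G \<gamma>)\<^esub> \<alpha> \<beta> (g \<rho>));
         P = {(\<beta>, \<rho>). \<beta> \<in> topspace (arrows G) \<and> \<rho> \<in> topspace (arrows G) \<and>
                       gd G \<beta> = gr G \<rho> \<and> gmult G \<beta> \<rho> = \<gamma>}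
     in finsum (\<O> (gr G \<gamma>)) F {q \<in> P. F q \<noteq> \<zero>\<^bsub>\<O> (gr G \<gamma>)\<^esub>})"

text \<open>This ring has in general no unit; the field \<open>one\<close> of the record is never used.\<close>

definition Gamma_c ::
    "('g, 'x) top_groupoid \<Rightarrow> 'e topology \<Rightarrow> ('g \<Rightarrow> 'e \<Rightarrow> 'e) \<Rightarrow> ('x \<Rightarrow> 'e ring) \<Rightarrow> ('g \<Rightarrow> 'e) ring" where
  "Gamma_c G E \<alpha> \<O> = \<lparr>
     carrier = generate (section_group G \<O>) (elementary_sections G E \<O>),
     mult = convolution G \<alpha> \<O>,
     one = undefined,
     zero = one (section_group G \<O>),
     add = mult (section_group G \<O>)\<rparr>"

section \<open>Primitive rings\<close>

text \<open>The library locale \<open>module\<close> requires a commutative unital ring and a unital action.\<close>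

locale left_module = M: abelian_group M
  for R :: "('r, 'k) ring_scheme" and M :: "('r, 'n) module" +
  assumes smult_closed: "\<lbrakk>a \<in> carrier R; x \<in> carrier M\<rbrakk> \<Longrightarrow> a \<odot>\<^bsub>M\<^esub> x \<in> carrier M"
    and smult_l_distr: "\<lbrakk>a \<in> carrier R; b \<in> carrier R; x \<in> carrier M\<rbrakk> \<Longrightarrow>
      (a \<oplus>\<^bsub>R\<^esub> b) \<odot>\<^bsub>M\<^esub> x = (a \<odot>\<^bsub>M\<^esub> x) \<oplus>\<^bsub>M\<^esub> (b \<odot>\<^bsub>M\<^esub> x)"
    and smult_r_distr: "\<lbrakk>a \<in> carrier R; x \<in> carrier M; y \<in> carrier M\<rbrakk> \<Longrightarrow>
      a \<odot>\<^bsub>M\<^esub> (x \<oplus>\<^bsub>M\<^esub> y) = (a \<odot>\<^bsub>M\<^esub> x) \<oplus>\<^bsub>M\<^esub> (a \<odot>\<^bsub>M\<^esub> y)"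
    and smult_assoc: "\<lbrakk>a \<in> carrier R; b \<in> carrier R; x \<in> carrier M\<rbrakk> \<Longrightarrow>
      (a \<otimes>\<^bsub>R\<^esub> b) \<odot>\<^bsub>M\<^esub> x = a \<odot>\<^bsub>M\<^esub> (b \<odot>\<^bsub>M\<^esub> x)"

definition simple_left_module :: "('r, 'k) ring_scheme \<Rightarrow> ('r, 'n) module \<Rightarrow> bool" where
  "simple_left_module R N \<longleftrightarrow> left_module R N \<and>
     (\<exists>a\<in>carrier R. \<exists>x\<in>carrier N. a \<odot>\<^bsub>N\<^esub> x \<noteq> \<zero>\<^bsub>N\<^esub>) \<and>
     (\<forall>H. submodule H R N \<longrightarrow> H = {\<zero>\<^bsub>N\<^esub>} \<or> H = carrier N)"

definition faithful_left_module :: "('r, 'k) ring_scheme \<Rightarrow> ('r, 'n) module \<Rightarrow> bool" where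
  "faithful_left_module R N \<longleftrightarrow> left_module R N \<and>
     (\<forall>a\<in>carrier R. (\<forall>x\<in>carrier N. a \<odot>\<^bsub>N\<^esub> x = \<zero>\<^bsub>N\<^esub>) \<longrightarrow> a = \<zero>\<^bsub>R\<^esub>)"

text \<open>The type argument names the type in which the module lives. A theorem assuming
  \<open>left_primitive TYPE('n) R\<close> with \<open>'n\<close> a type variable assumes a faithful simple module on an
  arbitrary type.\<close>

definition left_primitive :: "'n itself \<Rightarrow> ('r, 'k) ring_scheme \<Rightarrow> bool" where
  "left_primitive T R \<longleftrightarrow>
     (\<exists>N :: ('r, 'n) module. faithful_left_module R N \<and> simple_left_module R N)"

end

theory Submission
  imports Defs
begin

text \<open>Let \<open>N\<close> be a faithful simple module over the convolution ring, and for a compact open set \<open>U\<close>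
  of units let \<open>1\<^sub>U\<close> be its indicator function. Say that \<open>n\<close> has zero germ at \<open>y\<close> if \<open>1\<^sub>U n = 0\<close> for
  some \<open>U\<close> containing \<open>y\<close>. Since elementary sections have compact support and \<open>N\<close> is not annihilated
  by all of them, some \<open>n\<close> has a nonzero germ at some \<open>x\<close>. The elements with zero germs along the
  orbit of \<open>x\<close> form a submodule, because multiplication by an elementary section moves germs along
  an open bisection; as it misses \<open>n\<close>, it is \<open>0\<close>. If the orbit missed a nonempty compact open set
  \<open>W\<close>, then \<open>1\<^sub>W N\<close> would lie in this submodule, so \<open>1\<^sub>W\<close> would annihilate \<open>N\<close>, contradicting
  faithfulness.\<close>

text \<open>When all factorizations of \<gamma> but one contribute zero, the defining
  \<open>finsum\<close> runs over at most one pair. Both formulas for convolution with an indicator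
  are instances.\<close>

lemma convolution_eq_value:
  assumes "ring (\<O> (gr G \<gamma>))" and "\<gamma> \<in> topspace (arrows G)"
    and "\<beta> \<in> topspace (arrows G)" "\<rho> \<in> topspace (arrows G)" "gd G \<beta> = gr G \<rho>" "gmult G \<beta> \<rho> = \<gamma>"
    and "f \<beta> \<otimes>\<^bsub>\<O> (gr G \<gamma>)\<^esub> \<alpha> \<beta> (g \<rho>) = c" "c \<in> carrier (\<O> (gr G \<gamma>))"
    and other: "\<And>\<beta>' \<rho>'. \<lbrakk>\<beta>' \<in> topspace (arrows G); \<rho>' \<in> topspace (arrows G);
      gd G \<beta>' = gr G \<rho>'; gmult G \<beta>' \<rho>' = \<gamma>; (\<beta>', \<rho>') \<noteq> (\<beta>, \<rho>)\<rbrakk> \<Longrightarrow>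
      f \<beta>' \<otimes>\<^bsub>\<O> (gr G \<gamma>)\<^esub> \<alpha> \<beta>' (g \<rho>') = \<zero>\<^bsub>\<O> (gr G \<gamma>)\<^esub>"
  shows "convolution G \<alpha> \<O> f g \<gamma> = c"
proof -
  interpret ring "\<O> (gr G \<gamma>)" by fact
  define F where "F = (\<lambda>(\<beta>, \<rho>). f \<beta> \<otimes>\<^bsub>\<O> (gr G \<gamma>)\<^esub> \<alpha> \<beta> (g \<rho>))"
  define P where "P = {(\<beta>, \<rho>). \<beta> \<in> topspace (arrows G) \<and> \<rho> \<in> topspace (arrows G) \<and>
                       gd G \<beta> = gr G \<rho> \<and> gmult G \<beta> \<rho> = \<gamma>}"
  have "convolution G \<alpha> \<O> f g \<gamma> = finsum (\<O> (gr G \<gamma>)) F {q \<in> P. F q \<noteq> \<zero>\<^bsub>\<O> (gr G \<gamma>)\<^esub>}"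
    using assms(2) by (simp add: convolution_def F_def P_def Let_def)
  \<comment> \<open>If \<open>c\<close> is zero, the distinguished pair is itself excluded from the
    index set, and the empty sum supplies the value.\<close>
  moreover have "{q \<in> P. F q \<noteq> \<zero>\<^bsub>\<O> (gr G \<gamma>)\<^esub>} = (if c = \<zero>\<^bsub>\<O> (gr G \<gamma>)\<^esub> then {} else {(\<beta>, \<rho>)})"
    using assms by (auto simp: P_def F_def)
  moreover have "F (\<beta>, \<rho>) = c"
    using assms by (simp add: F_def)
  ultimately show ?thesis
    using assms(8) by auto
qed

section \<open>Zero and negatives in left modules\<close>

context left_module
begin

lemma smult_zero_right:
  assumes "a \<in> carrier R"
  shows "a \<odot>\<^bsub>M\<^esub> \<zero>\<^bsub>M\<^esub> = \<zero>\<^bsub>M\<^esub>"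
proof -
  have "a \<odot>\<^bsub>M\<^esub> \<zero>\<^bsub>M\<^esub> = a \<odot>\<^bsub>M\<^esub> \<zero>\<^bsub>M\<^esub> \<oplus>\<^bsub>M\<^esub> a \<odot>\<^bsub>M\<^esub> \<zero>\<^bsub>M\<^esub>"
    using smult_r_distr[OF assms M.zero_closed M.zero_closed] by simp
  then show ?thesis
    using smult_closed[OF assms M.zero_closed] by (metis M.add.l_cancel_one)
qed

lemma smult_a_inv:
  assumes "a \<in> carrier R" "x \<in> carrier M"
  shows "a \<odot>\<^bsub>M\<^esub> (\<ominus>\<^bsub>M\<^esub> x) = \<ominus>\<^bsub>M\<^esub> (a \<odot>\<^bsub>M\<^esub> x)"
proof -
  have "a \<odot>\<^bsub>M\<^esub> (\<ominus>\<^bsub>M\<^esub> x) \<oplus>\<^bsub>M\<^esub> a \<odot>\<^bsub>M\<^esub> x = \<zero>\<^bsub>M\<^esub>"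
    using smult_r_distr[of a "\<ominus>\<^bsub>M\<^esub> x" x] assms by (simp add: M.l_neg smult_zero_right)
  then show ?thesis
    using assms by (simp add: M.minus_equality smult_closed)
qed

text \<open>The locale imposes no axioms on \<open>R\<close>, so the two facts about its zero that
  the cancellation uses appear as hypotheses.\<close>

lemma smult_zero_left:
  assumes "\<zero>\<^bsub>R\<^esub> \<in> carrier R" "\<zero>\<^bsub>R\<^esub> \<oplus>\<^bsub>R\<^esub> \<zero>\<^bsub>R\<^esub> = \<zero>\<^bsub>R\<^esub>" "x \<in> carrier M"
  shows "\<zero>\<^bsub>R\<^esub> \<odot>\<^bsub>M\<^esub> x = \<zero>\<^bsub>M\<^esub>"
proof -
  have "\<zero>\<^bsub>R\<^esub> \<odot>\<^bsub>M\<^esub> x = \<zero>\<^bsub>R\<^esub> \<odot>\<^bsub>M\<^esub> x \<oplus>\<^bsub>M\<^esub> \<zero>\<^bsub>R\<^esub> \<odot>\<^bsub>M\<^esub> x"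
    using smult_l_distr[OF assms(1,1,3)] assms(2) by simp
  then show ?thesis
    using smult_closed[OF assms(1,3)] by (metis M.add.l_cancel_one)
qed

end

section \<open>Source, range and units of arrows\<close>

context inverse_semigroup_action
begin

abbreviation "G \<equiv> germ_groupoid X D \<theta>"

lemma units_G [simp]: "units G = X"
  by (simp add: germ_groupoid_def)

lemma theta_mem: "x \<in> D (star s) \<Longrightarrow> \<theta> s x \<in> topspace X"
  using theta_star(1) D_sub by blast

lemma arrowE:
  assumes "\<gamma> \<in> topspace (arrows G)"
  obtains s x where "x \<in> D (star s)" "\<gamma> = germ D s x" "gd G \<gamma> = x" "gr G \<gamma> = \<theta> s x"
  using assms gd_germ gr_germ unfolding topspace_germ_groupoid by blast

lemma gd_mem: "\<gamma> \<in> topspace (arrows G) \<Longrightarrow> gd G \<gamma> \<in> topspace X"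
  using D_sub by (elim arrowE) auto

lemma gr_mem: "\<gamma> \<in> topspace (arrows G) \<Longrightarrow> gr G \<gamma> \<in> topspace X"
  using theta_mem by (elim arrowE) auto

text \<open>The sets \<open>D s\<close> cover the space, and a point of \<open>D s\<close> also lies
  in the domain of the idempotent \<open>s * star s\<close>. Its germ is then the unit at that
  point.\<close>

lemma ex_idem:
  assumes "x \<in> topspace X"
  obtains e where "idem e" "x \<in> D e" "x \<in> D (star e)" "gunit G x = germ D e x"
proof -
  obtain s where s: "x \<in> D s"
    using assms covers by blast
  have "\<theta> (star s) x \<in> D (star s)"
    using theta_star(1)[of x "star s"] s by simp
  then have "x \<in> D (star (s * star s))"
    using s by (simp add: dom_mult_iff)
  then show thesis
    using that[of "s * star s"] gunit_germ idem_star_mult(2)[of s] star_idem by metis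
qed

lemma gunit_arrow:
  assumes "x \<in> topspace X"
  shows "gunit G x \<in> topspace (arrows G)" "gd G (gunit G x) = x" "gr G (gunit G x) = x"
proof -
  obtain e where e: "idem e" "x \<in> D e" "x \<in> D (star e)" "gunit G x = germ D e x"
    using ex_idem assms by blast
  show "gunit G x \<in> topspace (arrows G)"
    using e unfolding topspace_germ_groupoid by blast
  show "gd G (gunit G x) = x" "gr G (gunit G x) = x"
    using e theta_idem by (simp_all add: gd_germ gr_germ)
qed

lemma gd_gunit_image: "\<lbrakk>\<gamma> \<in> gunit G ` U; U \<subseteq> topspace X\<rbrakk> \<Longrightarrow> gd G \<gamma> \<in> U"
  using gunit_arrow(2) by (metis imageE subsetD)

lemma germ_le:
  assumes "nat_le u s" "x \<in> D (star u)"
  shows "germ D u x = germ D s x"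
  using germ_eq[of x u x s] assms theta_le(1)[OF assms] nat_le_refl by blast

text \<open>Units are germs of idempotents \<open>e\<close> and \<open>f\<close>. Both
  \<open>e * s\<close> and \<open>s * f\<close> lie below \<open>s\<close> in the natural order,
  hence have the same germ as \<open>s\<close> wherever they are defined.\<close>

lemma gmult_gunit:
  assumes "\<gamma> \<in> topspace (arrows G)"
  shows "gmult G (gunit G (gr G \<gamma>)) \<gamma> = \<gamma>" "gmult G \<gamma> (gunit G (gd G \<gamma>)) = \<gamma>"
proof -
  obtain s x where s: "x \<in> D (star s)" "\<gamma> = germ D s x" "gd G \<gamma> = x" "gr G \<gamma> = \<theta> s x"
    using arrowE assms by blast
  obtain e where e: "idem e" "\<theta> s x \<in> D e" "\<theta> s x \<in> D (star e)" "gunit G (\<theta> s x) = germ D e (\<theta> s x)"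
    using ex_idem theta_mem s by metis
  have "nat_le (e * s) s"
    using idem_conj[OF e(1), of s] by (auto simp: nat_le_def)
  then show "gmult G (gunit G (gr G \<gamma>)) \<gamma> = \<gamma>"
    using s e gmult_germ[of x s e] germ_le[of "e * s" s x] by (simp add: dom_mult_iff)
  obtain f where f: "idem f" "x \<in> D f" "x \<in> D (star f)" "gunit G x = germ D f x"
    using ex_idem gd_mem[OF assms] s by metis
  have "nat_le (s * f) s"
    using f by (auto simp: nat_le_def)
  then show "gmult G \<gamma> (gunit G (gd G \<gamma>)) = \<gamma>"
    using s f gmult_germ[of x f s] germ_le[of "s * f" s x] theta_idem[OF f(1,2)]
    by (simp add: dom_mult_iff)
qed

lemma gr_gmult:
  assumes "\<beta> \<in> topspace (arrows G)" "\<gamma> \<in> topspace (arrows G)" "gd G \<beta> = gr G \<gamma>"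
  shows "gr G (gmult G \<beta> \<gamma>) = gr G \<beta>"
proof -
  obtain s y where s: "y \<in> D (star s)" "\<beta> = germ D s y" "gd G \<beta> = y" "gr G \<beta> = \<theta> s y"
    using arrowE assms by blast
  obtain t x where t: "x \<in> D (star t)" "\<gamma> = germ D t x" "gd G \<gamma> = x" "gr G \<gamma> = \<theta> t x"
    using arrowE assms by blast
  show ?thesis
    using s t assms(3) gmult_germ[of x t s] gr_germ[of x "s * t"] comp_eq
    by (simp add: dom_mult_iff)
qed

section \<open>Topology of the groupoid of germs\<close>

lemma openin_germ_image: "\<lbrakk>openin X U; U \<subseteq> D (star s)\<rbrakk> \<Longrightarrow> openin (arrows G) (germ D s ` U)"
  unfolding germ_groupoid_def by (auto intro: topology_generated_by_Basis)

text \<open>Induction over the generation of the topology; the only case with content is a finite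
  intersection, where \<open>germ_basis_inter\<close> supplies a smaller generating set around
  \<gamma>.\<close>

lemma open_arrows_basis:
  assumes "openin (arrows G) V" "\<gamma> \<in> V"
  obtains s U where "openin X U" "U \<subseteq> D (star s)" "\<gamma> \<in> germ D s ` U" "germ D s ` U \<subseteq> V"
proof -
  have "generate_topology_on {germ D s ` U | s U. openin X U \<and> U \<subseteq> D (star s)} V"
    using assms(1) by (simp add: germ_groupoid_def openin_topology_generated_by_iff)
  then have "\<exists>s U. openin X U \<and> U \<subseteq> D (star s) \<and> \<gamma> \<in> germ D s ` U \<and> germ D s ` U \<subseteq> V"
    using assms(2)
  proof (induction rule: generate_topology_on.induct)
    case (Int a b)
    then have \<gamma>: "\<gamma> \<in> a" "\<gamma> \<in> b"
      by simp_all
    obtain s U where U: "openin X U" "U \<subseteq> D (star s)" "\<gamma> \<in> germ D s ` U" "germ D s ` U \<subseteq> a"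
      using Int.IH(1)[OF \<gamma>(1)] by (elim exE conjE)
    obtain t W where W: "openin X W" "W \<subseteq> D (star t)" "\<gamma> \<in> germ D t ` W" "germ D t ` W \<subseteq> b"
      using Int.IH(2)[OF \<gamma>(2)] by (elim exE conjE)
    obtain u Y where Y: "openin X Y" "Y \<subseteq> D (star u)" "\<gamma> \<in> germ D u ` Y"
        "germ D u ` Y \<subseteq> germ D s ` U \<inter> germ D t ` W"
      by (rule germ_basis_inter[OF U(1,2) W(1,2) IntI[OF U(3) W(3)]])
    then show ?case
      using order_trans[OF Y(4) Int_mono[OF U(4) W(4)]] Y(1-3) by (intro exI[of _ u] exI[of _ Y] conjI)
  next
    case (UN K)
    then show ?case
      by (meson UnionE Union_upper order_trans)
  qed auto
  then show thesis
    using that by blast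
qed

lemma continuous_gd: "continuous_map (arrows G) X (gd G)"
proof -
  have "openin (arrows G) {\<gamma> \<in> topspace (arrows G). gd G \<gamma> \<in> U}" if U: "openin X U" for U
  proof -
    have "{\<gamma> \<in> topspace (arrows G). gd G \<gamma> \<in> U} = (\<Union>s. germ D s ` (D (star s) \<inter> U))"
      unfolding topspace_germ_groupoid by (force simp: gd_germ)
    then show ?thesis
      using U open_D by (auto intro!: openin_Union openin_germ_image)
  qed
  then show ?thesis
    using gd_mem by (auto simp: continuous_map_def)
qed

text \<open>On the germs of a fixed \<open>s\<close> the range map is \<open>\<theta> s\<close>, so
  the preimage of an open set is assembled from its preimages under all the partial
  homeomorphisms.\<close>

lemma continuous_gr: "continuous_map (arrows G) X (gr G)"
proof -
  have "openin (arrows G) {\<gamma> \<in> topspace (arrows G). gr G \<gamma> \<in> U}" if U: "openin X U" for U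
  proof -
    have "openin X {x \<in> D (star s). \<theta> s x \<in> U}" for s
    proof -
      have "openin (subtopology X (D s)) (D s \<inter> U)"
        using U by (simp add: openin_subtopology_Int2)
      then have "openin (subtopology X (D (star s)))
          {x \<in> topspace (subtopology X (D (star s))). \<theta> s x \<in> D s \<inter> U}"
        using homeomorphic_imp_continuous_map[OF homeo[of s]] openin_continuous_map_preimage by blast
      moreover have "{x \<in> topspace (subtopology X (D (star s))). \<theta> s x \<in> D s \<inter> U} =
          {x \<in> D (star s). \<theta> s x \<in> U}"
        using D_sub theta_star(1) by auto
      ultimately show ?thesis
        using openin_trans_full open_D by metis
    qed
    moreover have "{\<gamma> \<in> topspace (arrows G). gr G \<gamma> \<in> U} =
        (\<Union>s. germ D s ` {x \<in> D (star s). \<theta> s x \<in> U})"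
      unfolding topspace_germ_groupoid by (force simp: gr_germ)
    ultimately show ?thesis
      by (auto intro!: openin_Union openin_germ_image)
  qed
  then show ?thesis
    using gr_mem by (auto simp: continuous_map_def)
qed

text \<open>On the germs of \<open>s\<close> the range map is \<open>\<theta> s\<close>, a
  homeomorphism onto the open set \<open>D s\<close>. This openness later yields neighbourhoods of
  orbit points.\<close>

lemma openin_gr_germ_image:
  assumes "openin X U" "U \<subseteq> D (star s)"
  shows "openin X (gr G ` germ D s ` U)"
proof -
  have "gr G ` germ D s ` U = \<theta> s ` U"
    using assms(2) gr_germ[of _ s] unfolding image_image by (intro image_cong) auto
  moreover have "openin (subtopology X (D s)) (\<theta> s ` U)"
    using homeomorphic_imp_open_map[OF homeo[of s]] assms
    by (metis open_map_def openin_subtopology_Int2 inf.absorb2)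
  ultimately show ?thesis
    using openin_trans_full open_D by metis
qed

lemma continuous_gunit: "continuous_map X (arrows G) (gunit G)"
proof -
  have "\<exists>T. openin X T \<and> x \<in> T \<and> T \<subseteq> {x \<in> topspace X. gunit G x \<in> V}"
    if V: "openin (arrows G) V" and x: "x \<in> topspace X" "gunit G x \<in> V" for V x
  proof -
    obtain s U where U: "openin X U" "U \<subseteq> D (star s)" "gunit G x \<in> germ D s ` U" "germ D s ` U \<subseteq> V"
      by (rule open_arrows_basis[OF V x(2)])
    obtain e where e: "idem e" "x \<in> D e" "x \<in> D (star e)" "gunit G x = germ D e x"
      using ex_idem x(1) by blast
    obtain y where "y \<in> U" "germ D e x = germ D s y"
      using U(3) e(4) by auto
    moreover have "y \<in> D (star s)"
      using U(2) \<open>y \<in> U\<close> by blast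
    \<comment> \<open>The unit at \<open>x\<close> is a germ of both \<open>e\<close> and
      \<open>s\<close>. An element \<open>u\<close> witnessing this lies below the idempotent
      \<open>e\<close>, hence is idempotent, and on \<open>U \<inter> D u\<close> every unit is a
      germ of \<open>s\<close>.\<close>
    ultimately obtain u where u: "nat_le u e" "nat_le u s" "x \<in> D (star u)" and xU: "x \<in> U"
      using germ_eq[OF e(3)] by blast
    have idu: "idem u"
      using u(1) e(1) idem_mult by (auto simp: nat_le_def)
    have "gunit G z \<in> V" if "z \<in> U" "z \<in> D u" for z
    proof -
      have "gunit G z = germ D s z"
        using gunit_germ[OF idu that(2)] germ_le[OF u(2)] that star_idem[OF idu] by simp
      then show ?thesis
        using that U(4) by auto
    qed
    moreover have "x \<in> D u"
      using u(3) star_idem[OF idu] by simp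
    ultimately show ?thesis
      using U(1) open_D[of u] xU D_sub[of u] by (intro exI[of _ "U \<inter> D u"]) auto
  qed
  then have "openin X {x \<in> topspace X. gunit G x \<in> V}" if "openin (arrows G) V" for V
    by (subst openin_subopen) (use that in blast)
  then show ?thesis
    using gunit_arrow(1) by (auto simp: continuous_map_def)
qed

text \<open>The unit at a point is the germ of every idempotent defined there, so a set of units is
  a union of basic sets given by idempotents.\<close>

lemma openin_gunit_image:
  assumes "openin X U"
  shows "openin (arrows G) (gunit G ` U)"
proof -
  have "gunit G ` U = (\<Union>e\<in>Collect idem. germ D e ` (D e \<inter> U))"
  proof (intro equalityI subsetI)
    fix \<gamma> assume "\<gamma> \<in> gunit G ` U"
    then obtain x where x: "x \<in> U" "\<gamma> = gunit G x"
      by blast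
    then obtain e where "idem e" "x \<in> D e" "gunit G x = germ D e x"
      using ex_idem assms openin_subset by (metis subsetD)
    then show "\<gamma> \<in> (\<Union>e\<in>Collect idem. germ D e ` (D e \<inter> U))"
      using x by auto
  qed (use gunit_germ in fastforce)
  then show ?thesis
    using assms open_D by (auto simp: star_idem intro!: openin_Union openin_germ_image)
qed

text \<open>The arrow space may fail to be Hausdorff, but the units in question map injectively and
  continuously to the Hausdorff space \<open>X\<close>, from which they inherit separation.\<close>

lemma compact_open_bisection_gunit:
  assumes "Hausdorff_space X" "openin X U" "compactin X U"
  shows "compact_open_bisection G (gunit G ` U)"
proof -
  have sub: "U \<subseteq> topspace X"
    using assms openin_subset by blast
  have inj: "inj_on (gd G) (gunit G ` U)" "inj_on (gr G) (gunit G ` U)"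
    using sub gunit_arrow by (auto simp: inj_on_def subset_iff)
  have "continuous_map (subtopology (arrows G) (gunit G ` U)) X (gd G)"
    using continuous_gd continuous_map_from_subtopology by blast
  then have "Hausdorff_space (subtopology (arrows G) (gunit G ` U))"
    using Hausdorff_space_injective_preimage[OF assms(1)] inj(1)
    by (metis inj_on_subset inf_le2 topspace_subtopology)
  then show ?thesis
    using inj openin_gunit_image assms image_compactin[OF assms(3) continuous_gunit]
    by (simp add: compact_open_bisection_def compact_Hausdorff_in_def)
qed

text \<open>A compact set in a Hausdorff space is closed, so the condition on the range cuts out a
  clopen set of arrows; intersecting with it preserves openness and compactness.\<close>

lemma compact_open_bisection_restrict:
  assumes "Hausdorff_space X" "compact_open_bisection G V" "openin X U" "compactin X U"
  shows "compact_open_bisection G (V \<inter> {\<gamma> \<in> topspace (arrows G). gr G \<gamma> \<in> U})"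
proof -
  have "closedin (arrows G) {\<gamma> \<in> topspace (arrows G). gr G \<gamma> \<in> U}"
    using closedin_continuous_map_preimage[OF continuous_gr] compactin_imp_closedin assms by blast
  moreover have "openin (arrows G) {\<gamma> \<in> topspace (arrows G). gr G \<gamma> \<in> U}"
    using openin_continuous_map_preimage[OF continuous_gr] assms by blast
  moreover have "Hausdorff_space (subtopology (arrows G) (V \<inter> {\<gamma> \<in> topspace (arrows G). gr G \<gamma> \<in> U}))"
    using assms(2) Hausdorff_space_subtopology
    by (fastforce simp: compact_open_bisection_def compact_Hausdorff_in_def simp flip: subtopology_subtopology)
  ultimately show ?thesis
    using assms(2) compact_Int_closedin
    by (auto simp: compact_open_bisection_def compact_Hausdorff_in_def inj_on_def)
qed

text \<open>If \<open>\<theta> s y = \<theta> t x\<close>, then \<open>y\<close> is the image of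
  \<open>x\<close> under \<open>star s * t\<close>. This lets a condition along the orbit be pulled
  back from the range of an arrow to its source.\<close>

lemma action_orbit_gd:
  assumes "\<gamma> \<in> topspace (arrows G)" "gr G \<gamma> \<in> action_orbit D \<theta> x"
  shows "gd G \<gamma> \<in> action_orbit D \<theta> x"
proof -
  obtain s y where s: "y \<in> D (star s)" "gd G \<gamma> = y" "gr G \<gamma> = \<theta> s y"
    using arrowE assms by metis
  obtain t where t: "x \<in> D (star t)" "\<theta> s y = \<theta> t x"
    using assms(2) s by (auto simp: action_orbit_def)
  have *: "\<theta> t x \<in> D (star (star s))"
    using theta_star(1)[OF s(1)] t by simp
  have "y = \<theta> (star s) (\<theta> t x)"
    using theta_star(2)[OF s(1)] t by simp
  then have "y = \<theta> (star s * t) x"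
    using comp_eq[OF t(1) *] by simp
  moreover have "x \<in> D (star (star s * t))"
    using * t by (simp add: dom_mult_iff)
  ultimately show ?thesis
    using s by (auto simp: action_orbit_def)
qed

lemma action_orbit_self: "x \<in> topspace X \<Longrightarrow> x \<in> action_orbit D \<theta> x"
proof -
  assume "x \<in> topspace X"
  then obtain e where "idem e" "x \<in> D e" "x \<in> D (star e)"
    using ex_idem by blast
  then show ?thesis
    using theta_idem[of e x] unfolding action_orbit_def by force
qed

end

section \<open>Compact open sets of units and the group of sections\<close>

locale germ_sheaf_of_rings =
  inverse_semigroup_action X D \<theta> + groupoid_sheaf_of_rings "germ_groupoid X D \<theta>" E p \<alpha> \<O>
  for X :: "'x topology"
    and D :: "'s::inverse_semigroup \<Rightarrow> 'x set"
    and \<theta> :: "'s \<Rightarrow> 'x \<Rightarrow> 'x"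
    and E :: "'e topology"
    and p :: "'e \<Rightarrow> 'x"
    and \<alpha> :: "('s \<times> 'x) set \<Rightarrow> 'e \<Rightarrow> 'e"
    and \<O> :: "'x \<Rightarrow> 'e ring" +
  assumes Hausdorff: "Hausdorff_space X"
    and zero_dim: "zero_dimensional_space X"
begin

abbreviation "SG \<equiv> section_group G \<O>"
abbreviation "A \<equiv> Gamma_c G E \<alpha> \<O>"

text \<open>These elements serve as local units: convolving with one on the left cuts a section down
  by range, and on the right by source. The restriction to arrows makes them members of the
  dependent product that carries \<open>SG\<close>.\<close>

definition unit_ind :: "'x set \<Rightarrow> ('s \<times> 'x) set \<Rightarrow> 'e" where
  "unit_ind U = (\<lambda>\<gamma>\<in>topspace (arrows G).
     if \<gamma> \<in> gunit G ` U then \<one>\<^bsub>\<O> (gr G \<gamma>)\<^esub> else \<zero>\<^bsub>\<O> (gr G \<gamma>)\<^esub>)"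

definition compact_open :: "'x set \<Rightarrow> bool" where
  "compact_open U \<longleftrightarrow> openin X U \<and> compactin X U"

lemma compact_open_sub: "compact_open U \<Longrightarrow> U \<subseteq> topspace X"
  by (simp add: compact_open_def openin_subset)

lemma compact_open_basis:
  assumes "openin X T" "x \<in> T"
  obtains U where "compact_open U" "x \<in> U" "U \<subseteq> T"
  using zero_dim assms unfolding zero_dimensional_space_def compact_open_def compact_Hausdorff_in_def
  by blast

lemma compact_open_Un: "\<lbrakk>compact_open U; compact_open V\<rbrakk> \<Longrightarrow> compact_open (U \<union> V)"
  by (simp add: compact_open_def compactin_Un openin_Un)

lemma compact_open_Int: "\<lbrakk>compact_open U; compact_open V\<rbrakk> \<Longrightarrow> compact_open (U \<inter> V)"
  using compactin_imp_closedin[OF Hausdorff] by (simp add: compact_open_def compact_Int_closedin openin_Int)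

lemma compact_open_Diff:
  assumes "compact_open U" "compact_open V"
  shows "compact_open (U - V)"
proof -
  have "U - V = U \<inter> (topspace X - V)"
    using compact_open_sub[OF assms(1)] by blast
  then show ?thesis
    using assms compactin_imp_closedin[OF Hausdorff]
    by (metis compact_open_def compact_Int_closedin closedin_def openin_Int openin_closedin_eq)
qed

lemma compact_open_separate:
  assumes "compactin X C" "y \<in> topspace X" "y \<notin> C"
  obtains U where "compact_open U" "y \<in> U" "U \<inter> C = {}"
proof -
  have "openin X (topspace X - C)" "y \<in> topspace X - C"
    using compactin_imp_closedin[OF Hausdorff assms(1)] assms(2,3) by auto
  then obtain U where "compact_open U" "y \<in> U" "U \<subseteq> topspace X - C"
    by (rule compact_open_basis)
  then show thesis
    by (intro that) auto
qed

lemma stalk: "\<gamma> \<in> topspace (arrows G) \<Longrightarrow> ring (\<O> (gr G \<gamma>))"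
  using stalk_ring gr_mem by simp

lemma carrier_SG: "carrier SG = (\<Pi>\<^sub>E \<gamma>\<in>topspace (arrows G). carrier (\<O> (gr G \<gamma>)))"
  by (simp add: section_group_def)

lemma SG_value: "\<lbrakk>f \<in> carrier SG; \<gamma> \<in> topspace (arrows G)\<rbrakk> \<Longrightarrow> f \<gamma> \<in> carrier (\<O> (gr G \<gamma>))"
  by (auto simp: carrier_SG)

lemma SG_eqI:
  "\<lbrakk>f \<in> carrier SG; g \<in> carrier SG; \<And>\<gamma>. \<gamma> \<in> topspace (arrows G) \<Longrightarrow> f \<gamma> = g \<gamma>\<rbrakk> \<Longrightarrow> f = g"
  unfolding carrier_SG by (rule PiE_ext)

lemma stalk_group: "\<gamma> \<in> topspace (arrows G) \<Longrightarrow> group (add_monoid (\<O> (gr G \<gamma>)))"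
  using stalk abelian_group.a_comm_group comm_group.axioms(2) ring.is_abelian_group by blast

sublocale SG: group SG
  unfolding section_group_def using stalk_group by simp

lemma SG_mult: "\<gamma> \<in> topspace (arrows G) \<Longrightarrow> (f \<otimes>\<^bsub>SG\<^esub> g) \<gamma> = f \<gamma> \<oplus>\<^bsub>\<O> (gr G \<gamma>)\<^esub> g \<gamma>"
  by (simp add: section_group_def)

lemma SG_one: "\<gamma> \<in> topspace (arrows G) \<Longrightarrow> \<one>\<^bsub>SG\<^esub> \<gamma> = \<zero>\<^bsub>\<O> (gr G \<gamma>)\<^esub>"
  by (simp add: section_group_def)

lemma elementary_in_SG: "elementary_sections G E \<O> \<subseteq> carrier SG"
  by (auto simp: elementary_sections_def)

lemma Gamma_c_simps [simp]:
  "carrier A = generate SG (elementary_sections G E \<O>)"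
  "zero A = \<one>\<^bsub>SG\<^esub>" "add A = mult SG" "mult A = convolution G \<alpha> \<O>"
  by (simp_all add: Gamma_c_def)

lemma A_in_SG: "f \<in> carrier A \<Longrightarrow> f \<in> carrier SG"
  using SG.generate_in_carrier[OF elementary_in_SG] by simp

lemma act_zero:
  assumes "\<gamma> \<in> topspace (arrows G)"
  shows "\<alpha> \<gamma> \<zero>\<^bsub>\<O> (gd G \<gamma>)\<^esub> = \<zero>\<^bsub>\<O> (gr G \<gamma>)\<^esub>"
  using ring_hom_zero[OF act_ring_hom[OF assms]] stalk_ring gd_mem gr_mem assms by simp

lemma act_one:
  assumes "\<gamma> \<in> topspace (arrows G)"
  shows "\<alpha> \<gamma> \<one>\<^bsub>\<O> (gd G \<gamma>)\<^esub> = \<one>\<^bsub>\<O> (gr G \<gamma>)\<^esub>"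
  using ring_hom_one[OF act_ring_hom[OF assms]] .

lemma act_gunit:
  assumes "x \<in> topspace X" "e \<in> carrier (\<O> x)"
  shows "\<alpha> (gunit G x) e = e"
  using act_unit[of e] stalk_carrier[of x] assms by auto

section \<open>Convolution with indicator functions\<close>

lemma unit_ind_SG: "unit_ind U \<in> carrier SG"
  using stalk by (auto simp: carrier_SG unit_ind_def intro!: ring.ring_simprules)

lemma unit_ind_gunit:
  assumes "U \<subseteq> topspace X" "x \<in> topspace X"
  shows "unit_ind U (gunit G x) = (if x \<in> U then \<one>\<^bsub>\<O> x\<^esub> else \<zero>\<^bsub>\<O> x\<^esub>)"
proof -
  have "x \<in> U" if "gunit G x \<in> gunit G ` U"
    using gd_gunit_image[OF that assms(1)] gunit_arrow(2)[OF assms(2)] by simp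
  then show ?thesis
    using gunit_arrow[OF assms(2)] by (auto simp: unit_ind_def)
qed

text \<open>The indicator vanishes off the units, and if \<beta> is a unit with \<beta>\<rho> =
  \<gamma>, then \<rho> = \<gamma> and \<beta> is the unit at the range of \<gamma>. Only that
  factorization can contribute.\<close>

lemma convolution_unit_ind_left:
  assumes f: "f \<in> carrier SG" and U: "U \<subseteq> topspace X" and \<gamma>: "\<gamma> \<in> topspace (arrows G)"
  shows "convolution G \<alpha> \<O> (unit_ind U) f \<gamma> = (if gr G \<gamma> \<in> U then f \<gamma> else \<zero>\<^bsub>\<O> (gr G \<gamma>)\<^esub>)"
proof -
  interpret R: ring "\<O> (gr G \<gamma>)" by (rule stalk[OF \<gamma>])
  note u = gunit_arrow[OF gr_mem[OF \<gamma>]]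
  show ?thesis
  proof (rule convolution_eq_value[where \<beta> = "gunit G (gr G \<gamma>)" and \<rho> = \<gamma>])
    show "unit_ind U (gunit G (gr G \<gamma>)) \<otimes>\<^bsub>\<O> (gr G \<gamma>)\<^esub> \<alpha> (gunit G (gr G \<gamma>)) (f \<gamma>) =
        (if gr G \<gamma> \<in> U then f \<gamma> else \<zero>\<^bsub>\<O> (gr G \<gamma>)\<^esub>)"
      using unit_ind_gunit[OF U gr_mem[OF \<gamma>]] act_gunit[OF gr_mem[OF \<gamma>]] SG_value[OF f \<gamma>] by simp
  next
    fix \<beta> \<rho>
    assume b: "\<beta> \<in> topspace (arrows G)" "\<rho> \<in> topspace (arrows G)" "gd G \<beta> = gr G \<rho>" "gmult G \<beta> \<rho> = \<gamma>"
      and ne: "(\<beta>, \<rho>) \<noteq> (gunit G (gr G \<gamma>), \<gamma>)"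
    have r: "gr G \<beta> = gr G \<gamma>"
      using gr_gmult[OF b(1-3)] b(4) by simp
    have "\<beta> \<notin> gunit G ` U"
    proof
      assume "\<beta> \<in> gunit G ` U"
      then obtain y where y: "y \<in> topspace X" "\<beta> = gunit G y"
        using U by blast
      then have "\<beta> = gunit G (gr G \<rho>)" "\<beta> = gunit G (gr G \<gamma>)"
        using gunit_arrow[OF y(1)] b(3) r by auto
      then show False
        using gmult_gunit(1)[OF b(2)] b(4) ne by metis
    qed
    then have "unit_ind U \<beta> = \<zero>\<^bsub>\<O> (gr G \<gamma>)\<^esub>"
      using b(1) r by (simp add: unit_ind_def)
    moreover have "\<alpha> \<beta> (f \<rho>) \<in> carrier (\<O> (gr G \<gamma>))"
      using ring_hom_closed[OF act_ring_hom[OF b(1)]] SG_value[OF f b(2)] b(3) r by simp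
    ultimately show "unit_ind U \<beta> \<otimes>\<^bsub>\<O> (gr G \<gamma>)\<^esub> \<alpha> \<beta> (f \<rho>) = \<zero>\<^bsub>\<O> (gr G \<gamma>)\<^esub>"
      by simp
  qed (use \<gamma> u gmult_gunit[OF \<gamma>] SG_value[OF f \<gamma>] R.ring_axioms in simp_all)
qed

text \<open>Dually, only the factorization of \<gamma> through the unit at its source can
  contribute. The value of the indicator passes through \<alpha>, which preserves zero and one as a
  ring homomorphism.\<close>

lemma convolution_unit_ind_right:
  assumes f: "f \<in> carrier SG" and U: "U \<subseteq> topspace X" and \<gamma>: "\<gamma> \<in> topspace (arrows G)"
  shows "convolution G \<alpha> \<O> f (unit_ind U) \<gamma> = (if gd G \<gamma> \<in> U then f \<gamma> else \<zero>\<^bsub>\<O> (gr G \<gamma>)\<^esub>)"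
proof -
  interpret R: ring "\<O> (gr G \<gamma>)" by (rule stalk[OF \<gamma>])
  note u = gunit_arrow[OF gd_mem[OF \<gamma>]]
  show ?thesis
  proof (rule convolution_eq_value[where \<beta> = \<gamma> and \<rho> = "gunit G (gd G \<gamma>)"])
    show "f \<gamma> \<otimes>\<^bsub>\<O> (gr G \<gamma>)\<^esub> \<alpha> \<gamma> (unit_ind U (gunit G (gd G \<gamma>))) =
        (if gd G \<gamma> \<in> U then f \<gamma> else \<zero>\<^bsub>\<O> (gr G \<gamma>)\<^esub>)"
      using unit_ind_gunit[OF U gd_mem[OF \<gamma>]] act_zero[OF \<gamma>] act_one[OF \<gamma>] SG_value[OF f \<gamma>] by simp
  next
    fix \<beta> \<rho>
    assume b: "\<beta> \<in> topspace (arrows G)" "\<rho> \<in> topspace (arrows G)" "gd G \<beta> = gr G \<rho>" "gmult G \<beta> \<rho> = \<gamma>"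
      and ne: "(\<beta>, \<rho>) \<noteq> (\<gamma>, gunit G (gd G \<gamma>))"
    have r: "gr G \<beta> = gr G \<gamma>"
      using gr_gmult[OF b(1-3)] b(4) by simp
    have "\<rho> \<notin> gunit G ` U"
    proof
      assume "\<rho> \<in> gunit G ` U"
      then obtain y where y: "y \<in> topspace X" "\<rho> = gunit G y"
        using U by blast
      then have "\<rho> = gunit G (gd G \<beta>)"
        using gunit_arrow[OF y(1)] b(3) by auto
      then show False
        using gmult_gunit(2)[OF b(1)] b(4) ne by metis
    qed
    then have "\<alpha> \<beta> (unit_ind U \<rho>) = \<zero>\<^bsub>\<O> (gr G \<gamma>)\<^esub>"
      using act_zero[OF b(1)] b(2,3) r by (simp add: unit_ind_def)
    moreover have "f \<beta> \<in> carrier (\<O> (gr G \<gamma>))"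
      using SG_value[OF f b(1)] r by simp
    ultimately show "f \<beta> \<otimes>\<^bsub>\<O> (gr G \<gamma>)\<^esub> \<alpha> \<beta> (unit_ind U \<rho>) = \<zero>\<^bsub>\<O> (gr G \<gamma>)\<^esub>"
      by simp
  qed (use \<gamma> u gmult_gunit[OF \<gamma>] SG_value[OF f \<gamma>] R.ring_axioms in simp_all)
qed

lemma convolution_unit_ind_SG:
  assumes "f \<in> carrier SG" "U \<subseteq> topspace X"
  shows "convolution G \<alpha> \<O> (unit_ind U) f \<in> carrier SG" "convolution G \<alpha> \<O> f (unit_ind U) \<in> carrier SG"
proof -
  have "\<zero>\<^bsub>\<O> (gr G \<gamma>)\<^esub> \<in> carrier (\<O> (gr G \<gamma>))" if "\<gamma> \<in> topspace (arrows G)" for \<gamma>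
    using stalk[OF that] by (rule ring.ring_simprules(2))
  moreover have "convolution G \<alpha> \<O> a b \<in> extensional (topspace (arrows G))" for a b
    by (simp add: convolution_def)
  ultimately show "convolution G \<alpha> \<O> (unit_ind U) f \<in> carrier SG"
    "convolution G \<alpha> \<O> f (unit_ind U) \<in> carrier SG"
    using SG_value[OF assms(1)] unfolding carrier_SG PiE_def
    by (simp_all add: convolution_unit_ind_left[OF assms] convolution_unit_ind_right[OF assms])
qed

text \<open>The required bisection consists of the units over \<open>U\<close>; there the indicator
  is the unit section composed with the range map, hence continuous.\<close>

lemma unit_ind_in_A:
  assumes "compact_open U"
  shows "unit_ind U \<in> carrier A"
proof -
  have U: "openin X U" "compactin X U" "U \<subseteq> topspace X"
    using assms compact_open_sub by (auto simp: compact_open_def)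
  have "continuous_map (subtopology (arrows G) (gunit G ` U)) E (\<lambda>\<gamma>. \<one>\<^bsub>\<O> (gr G \<gamma>)\<^esub>)"
    using continuous_map_compose[OF continuous_gr, of E "\<lambda>x. \<one>\<^bsub>\<O> x\<^esub>"] one_continuous
    by (simp add: o_def continuous_map_from_subtopology)
  then have "continuous_map (subtopology (arrows G) (gunit G ` U)) E (unit_ind U)"
    by (rule continuous_map_eq) (simp add: unit_ind_def)
  then have "unit_ind U \<in> elementary_sections G E \<O>"
    unfolding elementary_sections_def
    using unit_ind_SG compact_open_bisection_gunit[OF Hausdorff U(1,2)]
    by (auto simp: unit_ind_def intro!: exI[of _ "gunit G ` U"])
  then show ?thesis
    unfolding Gamma_c_simps by (rule generate.incl)
qed

text \<open>This places the product in \<open>carrier A\<close>, so that it can act on module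
  elements. The section is cut down by range, and the supporting bisection shrinks to its arrows
  with range in \<open>U\<close>.\<close>

lemma unit_ind_convolution_elementary:
  assumes U: "compact_open U" and f: "f \<in> elementary_sections G E \<O>"
  shows "convolution G \<alpha> \<O> (unit_ind U) f \<in> elementary_sections G E \<O>"
proof -
  obtain V where V: "f \<in> carrier SG" "compact_open_bisection G V"
      "continuous_map (subtopology (arrows G) V) E f"
      "\<And>\<gamma>. \<gamma> \<in> topspace (arrows G) - V \<Longrightarrow> f \<gamma> = \<zero>\<^bsub>\<O> (gr G \<gamma>)\<^esub>"
    using f unfolding elementary_sections_def by blast
  define W where "W = V \<inter> {\<gamma> \<in> topspace (arrows G). gr G \<gamma> \<in> U}"
  note conv = convolution_unit_ind_left[OF V(1) compact_open_sub[OF U]]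
  have "continuous_map (subtopology (arrows G) W) E f"
    using continuous_map_from_subtopology_mono[OF V(3)] by (simp add: W_def)
  then have "continuous_map (subtopology (arrows G) W) E (convolution G \<alpha> \<O> (unit_ind U) f)"
    by (rule continuous_map_eq) (simp add: W_def conv)
  moreover have "compact_open_bisection G W"
    using compact_open_bisection_restrict[OF Hausdorff V(2)] U by (simp add: W_def compact_open_def)
  moreover have "convolution G \<alpha> \<O> (unit_ind U) f \<gamma> = \<zero>\<^bsub>\<O> (gr G \<gamma>)\<^esub>"
    if "\<gamma> \<in> topspace (arrows G) - W" for \<gamma>
    using that V(4) conv by (auto simp: W_def)
  ultimately show ?thesis
    using convolution_unit_ind_SG(1)[OF V(1) compact_open_sub[OF U]]
    unfolding elementary_sections_def by blast
qed

text \<open>Removing \<open>U\<close> from \<open>V\<close> makes the two pieces disjoint, so no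
  unit receives the value one twice.\<close>

lemma unit_ind_Un:
  assumes "compact_open U" "compact_open V"
  shows "unit_ind (U \<union> V) = unit_ind U \<otimes>\<^bsub>SG\<^esub> unit_ind (V - U)"
proof (rule SG_eqI)
  fix \<gamma> assume \<gamma>: "\<gamma> \<in> topspace (arrows G)"
  interpret R: ring "\<O> (gr G \<gamma>)" by (rule stalk[OF \<gamma>])
  have "\<gamma> \<notin> gunit G ` (V - U)" if "\<gamma> \<in> gunit G ` U"
    using gd_gunit_image[OF that compact_open_sub[OF assms(1)]] gd_gunit_image[of \<gamma> "V - U"]
      compact_open_sub[OF assms(2)] by blast
  then show "unit_ind (U \<union> V) \<gamma> = (unit_ind U \<otimes>\<^bsub>SG\<^esub> unit_ind (V - U)) \<gamma>"
    using \<gamma> by (auto simp: SG_mult unit_ind_def)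
qed (simp_all add: unit_ind_SG)

lemma convolution_unit_ind_subset:
  assumes "compact_open U" "compact_open V" "U \<subseteq> V"
  shows "convolution G \<alpha> \<O> (unit_ind U) (unit_ind V) = unit_ind U"
proof (rule SG_eqI)
  fix \<gamma> assume \<gamma>: "\<gamma> \<in> topspace (arrows G)"
  have "gd G \<gamma> \<in> V" if "\<gamma> \<in> gunit G ` U"
    using gd_gunit_image[OF that compact_open_sub[OF assms(1)]] assms(3) by blast
  then show "convolution G \<alpha> \<O> (unit_ind U) (unit_ind V) \<gamma> = unit_ind U \<gamma>"
    using \<gamma> convolution_unit_ind_right[OF unit_ind_SG compact_open_sub[OF assms(2)] \<gamma>]
    by (auto simp: unit_ind_def)
qed (simp_all add: unit_ind_SG convolution_unit_ind_SG compact_open_sub assms)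

lemma convolution_unit_ind_disjoint:
  assumes "compact_open U" "compact_open V" "U \<inter> V = {}"
  shows "convolution G \<alpha> \<O> (unit_ind U) (unit_ind V) = \<one>\<^bsub>SG\<^esub>"
proof (rule SG_eqI)
  fix \<gamma> assume \<gamma>: "\<gamma> \<in> topspace (arrows G)"
  have "gd G \<gamma> \<notin> V" if "\<gamma> \<in> gunit G ` U"
    using gd_gunit_image[OF that compact_open_sub[OF assms(1)]] assms(3) by blast
  then show "convolution G \<alpha> \<O> (unit_ind U) (unit_ind V) \<gamma> = \<one>\<^bsub>SG\<^esub> \<gamma>"
    using \<gamma> convolution_unit_ind_right[OF unit_ind_SG compact_open_sub[OF assms(2)] \<gamma>]
    by (auto simp: unit_ind_def SG_one)
qed (simp_all add: unit_ind_SG convolution_unit_ind_SG compact_open_sub assms)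

text \<open>At a unit over a point of \<open>U\<close> the indicator takes the value one, which
  differs from zero in the stalk. This is what allows faithfulness to be applied to an
  indicator.\<close>

lemma unit_ind_nonzero:
  assumes "compact_open U" "U \<noteq> {}"
  shows "unit_ind U \<noteq> \<one>\<^bsub>SG\<^esub>"
proof -
  obtain x where x: "x \<in> U" "x \<in> topspace X"
    using assms compact_open_sub by blast
  have "unit_ind U (gunit G x) \<noteq> \<one>\<^bsub>SG\<^esub> (gunit G x)"
    using unit_ind_gunit[OF compact_open_sub[OF assms(1)] x(2)] x gunit_arrow[OF x(2)]
      stalk_one_neq_zero[of x] by (simp add: SG_one)
  then show ?thesis
    by auto
qed

end

section \<open>Annihilation of module elements by indicators\<close>

locale germ_sheaf_module =
  germ_sheaf_of_rings X D \<theta> E p \<alpha> \<O> + N: left_module "Gamma_c (germ_groupoid X D \<theta>) E \<alpha> \<O>" N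
  for X :: "'x topology"
    and D :: "'s::inverse_semigroup \<Rightarrow> 'x set"
    and \<theta> :: "'s \<Rightarrow> 'x \<Rightarrow> 'x"
    and E :: "'e topology"
    and p :: "'e \<Rightarrow> 'x"
    and \<alpha> :: "('s \<times> 'x) set \<Rightarrow> 'e \<Rightarrow> 'e"
    and \<O> :: "'x \<Rightarrow> 'e ring"
    and N :: "(('s \<times> 'x) set \<Rightarrow> 'e, 'n) module" (structure)
begin

lemma zero_smult: "n \<in> carrier N \<Longrightarrow> \<one>\<^bsub>SG\<^esub> \<odot> n = \<zero>"
  using N.smult_zero_left by (simp add: generate.one)

text \<open>Induction over the additive generation of \<open>A\<close> with \<open>n\<close> fixed.
  Leaving \<open>H\<close> an arbitrary subgroup covers both uses: the zero subgroup and the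
  submodule attached to an orbit.\<close>

lemma smult_mem_if_elementary:
  assumes H: "subgroup H (add_monoid N)" and n: "n \<in> carrier N"
    and el: "\<And>a. a \<in> elementary_sections G E \<O> \<Longrightarrow> a \<odot> n \<in> H"
    and a: "a \<in> carrier A"
  shows "a \<odot> n \<in> H"
proof -
  have "a \<in> generate SG (elementary_sections G E \<O>)"
    using a by simp
  then show ?thesis
  proof (induction rule: generate.induct)
    case one
    then show ?case
      using zero_smult[OF n] subgroup.one_closed[OF H] by simp
  next
    case (inv h)
    have h: "h \<in> carrier A" "inv\<^bsub>SG\<^esub> h \<in> carrier A"
      using inv by (auto intro: generate.intros)
    have "inv\<^bsub>SG\<^esub> h \<odot> n \<oplus> h \<odot> n = (inv\<^bsub>SG\<^esub> h \<otimes>\<^bsub>SG\<^esub> h) \<odot> n"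
      using N.smult_l_distr[OF h(2,1) n] by simp
    also have "\<dots> = \<zero>"
      using A_in_SG[OF h(1)] zero_smult[OF n] by simp
    finally have "inv\<^bsub>SG\<^esub> h \<odot> n = \<ominus> (h \<odot> n)"
      using N.smult_closed h n by (simp add: N.M.minus_equality)
    then show ?case
      using subgroup.m_inv_closed[OF H el[OF inv]] by (simp add: a_inv_def)
  next
    case (eng h1 h2)
    then show ?case
      using N.smult_l_distr[of h1 h2 n] n subgroup.m_closed[OF H eng.IH] by simp
  qed (rule el)
qed

text \<open>Since \<open>unit_ind U\<close> absorbs \<open>unit_ind V\<close> under convolution,
  annihilation of \<open>n\<close> passes to smaller compact open sets; having zero germ is thus a
  local condition.\<close>

lemma unit_ind_smult_mono:
  assumes "compact_open U" "compact_open V" "U \<subseteq> V" "n \<in> carrier N" "unit_ind V \<odot> n = \<zero>"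
  shows "unit_ind U \<odot> n = \<zero>"
proof -
  have "unit_ind U \<odot> n = unit_ind U \<odot> (unit_ind V \<odot> n)"
    using N.smult_assoc[OF unit_ind_in_A unit_ind_in_A assms(4), of U V]
      convolution_unit_ind_subset[OF assms(1-3)] assms(1,2) by simp
  then show ?thesis
    using assms N.smult_zero_right unit_ind_in_A by simp
qed

lemma unit_ind_smult_Un:
  assumes "compact_open U" "compact_open V" "n \<in> carrier N" "unit_ind U \<odot> n = \<zero>" "unit_ind V \<odot> n = \<zero>"
  shows "unit_ind (U \<union> V) \<odot> n = \<zero>"
proof -
  have VU: "compact_open (V - U)"
    using compact_open_Diff assms by blast
  have "unit_ind (U \<union> V) \<odot> n = unit_ind U \<odot> n \<oplus> unit_ind (V - U) \<odot> n"
    using N.smult_l_distr[OF unit_ind_in_A[OF assms(1)] unit_ind_in_A[OF VU] assms(3)]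
      unit_ind_Un[OF assms(1,2)] by simp
  moreover have "unit_ind (V - U) \<odot> n = \<zero>"
    using unit_ind_smult_mono[OF VU assms(2) _ assms(3,5)] by blast
  ultimately show ?thesis
    using assms by simp
qed

text \<open>An element supported on arrows with source in \<open>Z\<close> is unchanged by right
  convolution with \<open>unit_ind Z\<close>, so its action on \<open>n\<close> factors through
  \<open>unit_ind Z \<odot> n\<close>.\<close>

lemma smult_eq_zero_if_supp:
  assumes a: "a \<in> carrier A" and Z: "compact_open Z" and n: "n \<in> carrier N" "unit_ind Z \<odot> n = \<zero>"
    and supp: "\<And>\<gamma>. \<lbrakk>\<gamma> \<in> topspace (arrows G); gd G \<gamma> \<notin> Z\<rbrakk> \<Longrightarrow> a \<gamma> = \<zero>\<^bsub>\<O> (gr G \<gamma>)\<^esub>"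
  shows "a \<odot> n = \<zero>"
proof -
  note Zs = compact_open_sub[OF Z]
  have "convolution G \<alpha> \<O> a (unit_ind Z) = a"
    by (rule SG_eqI) (use A_in_SG[OF a] supp in
      \<open>simp_all add: convolution_unit_ind_SG[OF _ Zs] convolution_unit_ind_right[OF _ Zs]\<close>)
  then have "a \<odot> n = a \<odot> (unit_ind Z \<odot> n)"
    using N.smult_assoc[OF a unit_ind_in_A[OF Z] n(1)] by simp
  then show ?thesis
    using n N.smult_zero_right[OF a] by simp
qed

text \<open>Otherwise the compact open sets whose indicators annihilate \<open>n\<close> cover the
  space. They are closed under finite unions, so one of them contains the compact set of sources of
  any given elementary section. Every elementary section then annihilates \<open>n\<close>, and so
  does all of \<open>A\<close>.\<close>

lemma ex_nonzero_germ:
  assumes "a \<in> carrier A" "n \<in> carrier N" "a \<odot> n \<noteq> \<zero>"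
  shows "\<exists>x \<in> topspace X. \<forall>U. compact_open U \<and> x \<in> U \<longrightarrow> unit_ind U \<odot> n \<noteq> \<zero>"
proof (rule ccontr)
  assume "\<not> ?thesis"
  then have cover: "\<exists>U. compact_open U \<and> x \<in> U \<and> unit_ind U \<odot> n = \<zero>" if "x \<in> topspace X" for x
    using that by blast
  define \<U> where "\<U> = {U. compact_open U \<and> unit_ind U \<odot> n = \<zero>}"
  have fin: "\<Union>F \<in> \<U>" if "finite F" "F \<subseteq> \<U>" for F
    using that
  proof (induction rule: finite_induct)
    \<comment> \<open>The empty subfamily is possible too: the indicator of the empty set is the
      zero section, so it annihilates \<open>n\<close>.\<close>
    case empty
    have "unit_ind {} = \<one>\<^bsub>SG\<^esub>"
      by (rule SG_eqI) (simp_all add: unit_ind_SG, simp add: unit_ind_def SG_one)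
    then show ?case
      using zero_smult[OF assms(2)] by (simp add: \<U>_def compact_open_def)
  next
    case (insert U F)
    then show ?case
      using unit_ind_smult_Un[OF _ _ assms(2)] compact_open_Un by (simp add: \<U>_def)
  qed
  have "f \<odot> n \<in> {\<zero>}" if f: "f \<in> elementary_sections G E \<O>" for f
  proof -
    obtain V where V: "compact_open_bisection G V"
        "\<And>\<gamma>. \<gamma> \<in> topspace (arrows G) - V \<Longrightarrow> f \<gamma> = \<zero>\<^bsub>\<O> (gr G \<gamma>)\<^esub>"
      using f unfolding elementary_sections_def by blast
    have "compactin X (gd G ` V)"
      using V(1) image_compactin continuous_gd
      by (auto simp: compact_open_bisection_def compact_Hausdorff_in_def)
    moreover have "gd G ` V \<subseteq> \<Union>\<U>"
    proof -
      have "V \<subseteq> topspace (arrows G)"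
        using V(1) openin_subset by (auto simp: compact_open_bisection_def)
      then show ?thesis
        using cover gd_mem by (fastforce simp: \<U>_def)
    qed
    ultimately obtain F where F: "finite F" "F \<subseteq> \<U>" "gd G ` V \<subseteq> \<Union>F"
      using compactinD[of X "gd G ` V" \<U>] by (auto simp: \<U>_def compact_open_def)
    then have "compact_open (\<Union>F)" "unit_ind (\<Union>F) \<odot> n = \<zero>"
      using fin by (auto simp: \<U>_def)
    moreover have "f \<gamma> = \<zero>\<^bsub>\<O> (gr G \<gamma>)\<^esub>" if "\<gamma> \<in> topspace (arrows G)" "gd G \<gamma> \<notin> \<Union>F" for \<gamma>
      using that F(3) V(2) by blast
    ultimately show ?thesis
      using smult_eq_zero_if_supp[of f "\<Union>F" n] f assms(2) by (simp add: generate.incl)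
  qed
  then show False
    using smult_mem_if_elementary[OF _ assms(2) _ assms(1), of "{\<zero>}"] assms(3)
      N.M.add.triv_subgroup by auto
qed

section \<open>The submodule of elements with zero germs along an orbit\<close>

definition vanishing_on_orbit :: "'x \<Rightarrow> 'n set" where
  "vanishing_on_orbit x = {n \<in> carrier N. \<forall>y \<in> topspace X \<inter> action_orbit D \<theta> x.
     \<exists>U. compact_open U \<and> y \<in> U \<and> unit_ind U \<odot> n = \<zero>}"

text \<open>Let \<open>V\<close> be a bisection supporting \<open>f\<close>. At an orbit point that
  is the range of an arrow of \<open>V\<close>, the germ of \<open>f \<odot> n\<close> is controlled
  by that of \<open>n\<close> at the source, which is again on the orbit. At any other orbit point
  \<open>f\<close> contributes nothing nearby.\<close>

lemma smult_vanishing_on_orbit_elementary: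
  assumes f: "f \<in> elementary_sections G E \<O>" and n: "n \<in> vanishing_on_orbit x"
  shows "f \<odot> n \<in> vanishing_on_orbit x"
proof -
  have nN: "n \<in> carrier N"
    using n by (simp add: vanishing_on_orbit_def)
  have fA: "f \<in> carrier A"
    using f by (simp add: generate.incl)
  obtain V where V: "compact_open_bisection G V"
      "\<And>\<gamma>. \<gamma> \<in> topspace (arrows G) - V \<Longrightarrow> f \<gamma> = \<zero>\<^bsub>\<O> (gr G \<gamma>)\<^esub>"
    using f unfolding elementary_sections_def by blast
  have Vs: "V \<subseteq> topspace (arrows G)" and Vo: "openin (arrows G) V"
    using V(1) openin_subset by (auto simp: compact_open_bisection_def)
  \<comment> \<open>The product of \<open>unit_ind U\<close> and \<open>f\<close> is supported on
    the arrows of \<open>V\<close> with range in \<open>U\<close>. If their sources lie in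
    \<open>Z\<close>, it annihilates \<open>n\<close> together with
    \<open>unit_ind Z\<close>.\<close>
  have key: "unit_ind U \<odot> (f \<odot> n) = \<zero>"
    if U: "compact_open U" and Z: "compact_open Z" "unit_ind Z \<odot> n = \<zero>"
      and sub: "\<And>\<gamma>. \<lbrakk>\<gamma> \<in> V; gr G \<gamma> \<in> U\<rbrakk> \<Longrightarrow> gd G \<gamma> \<in> Z" for U Z
  proof -
    have "convolution G \<alpha> \<O> (unit_ind U) f \<gamma> = \<zero>\<^bsub>\<O> (gr G \<gamma>)\<^esub>"
      if "\<gamma> \<in> topspace (arrows G)" "gd G \<gamma> \<notin> Z" for \<gamma>
      using that sub[of \<gamma>] V(2)[of \<gamma>]
        convolution_unit_ind_left[OF A_in_SG[OF fA] compact_open_sub[OF U] that(1)] by auto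
    then have "convolution G \<alpha> \<O> (unit_ind U) f \<odot> n = \<zero>"
      using smult_eq_zero_if_supp[of "convolution G \<alpha> \<O> (unit_ind U) f" Z n]
        unit_ind_convolution_elementary[OF U f] Z nN by (simp add: generate.incl)
    then show ?thesis
      using N.smult_assoc[OF unit_ind_in_A[OF U] fA nN] by simp
  qed
  have "\<exists>U. compact_open U \<and> y \<in> U \<and> unit_ind U \<odot> (f \<odot> n) = \<zero>"
    if y: "y \<in> topspace X" "y \<in> action_orbit D \<theta> x" for y
  proof (cases "y \<in> gr G ` V")
    case True
    then obtain \<gamma> where \<gamma>: "\<gamma> \<in> V" "y = gr G \<gamma>" "\<gamma> \<in> topspace (arrows G)"
      using Vs by blast
    then have "gd G \<gamma> \<in> topspace X \<inter> action_orbit D \<theta> x"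
      using gd_mem action_orbit_gd y by blast
    then obtain Z where Z: "compact_open Z" "gd G \<gamma> \<in> Z" "unit_ind Z \<odot> n = \<zero>"
      using n by (auto simp: vanishing_on_orbit_def)
    \<comment> \<open>Around \<gamma> the bisection contains a set of germs of one element
      \<open>s\<close>; limiting their sources to \<open>Z\<close> keeps the set of their ranges an
      open neighbourhood of \<open>y\<close>.\<close>
    obtain s B where B: "openin X B" "B \<subseteq> D (star s)" "\<gamma> \<in> germ D s ` B" "germ D s ` B \<subseteq> V"
      by (rule open_arrows_basis[OF Vo \<gamma>(1)])
    have "openin X (B \<inter> Z)"
      using B Z by (simp add: compact_open_def openin_Int)
    then have "openin X (gr G ` germ D s ` (B \<inter> Z))"
      using openin_gr_germ_image B(2) by blast
    moreover have "y \<in> gr G ` germ D s ` (B \<inter> Z)"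
      using B(2,3) Z(2) \<gamma>(2) gd_germ by force
    ultimately obtain U where U: "compact_open U" "y \<in> U" "U \<subseteq> gr G ` germ D s ` (B \<inter> Z)"
      by (rule compact_open_basis)
    \<comment> \<open>An arrow of \<open>V\<close> with range in \<open>U\<close> shares its range
      with a germ of \<open>s\<close> over \<open>B \<inter> Z\<close>. As the range map is
      injective on \<open>V\<close>, the two arrows coincide.\<close>
    have "gd G \<delta> \<in> Z" if \<delta>: "\<delta> \<in> V" "gr G \<delta> \<in> U" for \<delta>
    proof -
      obtain z where z: "z \<in> B" "z \<in> Z" "gr G \<delta> = gr G (germ D s z)"
        using U(3) \<delta>(2) by blast
      have "inj_on (gr G) V" "germ D s z \<in> V"
        using V(1) B(4) z(1) by (auto simp: compact_open_bisection_def)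
      then have "\<delta> = germ D s z"
        using inj_onD[OF _ z(3) \<delta>(1)] by blast
      then show ?thesis
        using z B(2) gd_germ by auto
    qed
    then show ?thesis
      using key[OF U(1) Z(1,3)] U by blast
  next
    case False
    \<comment> \<open>The ranges of \<open>V\<close> form a compact set missing \<open>y\<close>, so
      some compact open neighbourhood of \<open>y\<close> avoids it.\<close>
    have "compactin X (gr G ` V)"
      using V(1) image_compactin continuous_gr
      by (auto simp: compact_open_bisection_def compact_Hausdorff_in_def)
    then obtain U where U: "compact_open U" "y \<in> U" "U \<inter> gr G ` V = {}"
      by (rule compact_open_separate[OF _ y(1) False])
    \<comment> \<open>Any annihilating \<open>Z\<close> will do, since no arrow of \<open>V\<close>
      has range in \<open>U\<close> and the condition on sources is vacuous; the one given by the
      germ of \<open>n\<close> at \<open>y\<close> is taken.\<close>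
    obtain Z where Z: "compact_open Z" "unit_ind Z \<odot> n = \<zero>"
      using n y by (auto simp: vanishing_on_orbit_def)
    show ?thesis
      using key[OF U(1) Z] U by blast
  qed
  then show ?thesis
    using N.smult_closed[OF fA nN] by (simp add: vanishing_on_orbit_def)
qed

text \<open>For sums, the neighbourhoods annihilating the two summands at a point are intersected;
  in a Hausdorff space the intersection is again compact open.\<close>

lemma subgroup_vanishing_on_orbit: "subgroup (vanishing_on_orbit x) (add_monoid N)"
proof (rule subgroup.intro)
  show "vanishing_on_orbit x \<subseteq> carrier (add_monoid N)"
    by (auto simp: vanishing_on_orbit_def)
  show "\<one>\<^bsub>add_monoid N\<^esub> \<in> vanishing_on_orbit x"
  proof -
    have "\<exists>U. compact_open U \<and> y \<in> U \<and> unit_ind U \<odot> \<zero> = \<zero>" if y: "y \<in> topspace X" for y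
    proof -
      obtain U where "compact_open U" "y \<in> U" "U \<subseteq> topspace X"
        by (rule compact_open_basis[OF openin_topspace y])
      then show ?thesis
        using N.smult_zero_right[OF unit_ind_in_A] by blast
    qed
    then show ?thesis
      by (simp add: vanishing_on_orbit_def)
  qed
next
  fix m n assume mn: "m \<in> vanishing_on_orbit x" "n \<in> vanishing_on_orbit x"
  then have c: "m \<in> carrier N" "n \<in> carrier N"
    by (auto simp: vanishing_on_orbit_def)
  have "\<exists>U. compact_open U \<and> y \<in> U \<and> unit_ind U \<odot> (m \<oplus> n) = \<zero>"
    if y: "y \<in> topspace X \<inter> action_orbit D \<theta> x" for y
  proof -
    obtain U V where U: "compact_open U" "y \<in> U" "unit_ind U \<odot> m = \<zero>"
      and V: "compact_open V" "y \<in> V" "unit_ind V \<odot> n = \<zero>"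
      using mn y unfolding vanishing_on_orbit_def by blast
    have UV: "compact_open (U \<inter> V)"
      using compact_open_Int U V by blast
    have "unit_ind (U \<inter> V) \<odot> m = \<zero>" "unit_ind (U \<inter> V) \<odot> n = \<zero>"
      using unit_ind_smult_mono[OF UV] U V c by auto
    then have "unit_ind (U \<inter> V) \<odot> (m \<oplus> n) = \<zero>"
      using N.smult_r_distr[OF unit_ind_in_A[OF UV] c] by simp
    then show ?thesis
      using UV U V by blast
  qed
  then show "m \<otimes>\<^bsub>add_monoid N\<^esub> n \<in> vanishing_on_orbit x"
    using c by (simp add: vanishing_on_orbit_def)
next
  fix n assume n: "n \<in> vanishing_on_orbit x"
  then have "n \<in> carrier N"
    by (auto simp: vanishing_on_orbit_def)
  then show "inv\<^bsub>add_monoid N\<^esub> n \<in> vanishing_on_orbit x"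
    using n N.smult_a_inv unit_ind_in_A
    unfolding vanishing_on_orbit_def a_inv_def[symmetric] by fastforce
qed

lemma submodule_vanishing_on_orbit: "submodule (vanishing_on_orbit x) A N"
proof (intro submodule.intro submodule_axioms.intro subgroup_vanishing_on_orbit)
  fix a n assume a: "a \<in> carrier A" and n: "n \<in> vanishing_on_orbit x"
  have "n \<in> carrier N"
    using n by (simp add: vanishing_on_orbit_def)
  then show "a \<odot> n \<in> vanishing_on_orbit x"
    by (rule smult_mem_if_elementary[OF subgroup_vanishing_on_orbit _ _ a])
      (rule smult_vanishing_on_orbit_elementary[OF _ n])
qed

text \<open>Each orbit point lies off the compact set \<open>W\<close>, so it has a compact open
  neighbourhood disjoint from \<open>W\<close>, and indicators of disjoint sets convolve to
  zero.\<close>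

lemma unit_ind_smult_vanishing_on_orbit:
  assumes W: "compact_open W" "W \<inter> action_orbit D \<theta> x = {}" and m: "m \<in> carrier N"
  shows "unit_ind W \<odot> m \<in> vanishing_on_orbit x"
proof -
  have "\<exists>U. compact_open U \<and> y \<in> U \<and> unit_ind U \<odot> (unit_ind W \<odot> m) = \<zero>"
    if y: "y \<in> topspace X" "y \<in> action_orbit D \<theta> x" for y
  proof -
    have "compactin X W" "y \<notin> W"
      using W y by (auto simp: compact_open_def)
    then obtain U where U: "compact_open U" "y \<in> U" "U \<inter> W = {}"
      using y(1) by (metis compact_open_separate)
    have "unit_ind U \<odot> (unit_ind W \<odot> m) = \<one>\<^bsub>SG\<^esub> \<odot> m"
      using N.smult_assoc[OF unit_ind_in_A[OF U(1)] unit_ind_in_A[OF W(1)] m]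
        convolution_unit_ind_disjoint[OF U(1) W(1) U(3)] by simp
    then show ?thesis
      using U zero_smult[OF m] by auto
  qed
  then show ?thesis
    using N.smult_closed[OF unit_ind_in_A[OF W(1)] m] by (simp add: vanishing_on_orbit_def)
qed

section \<open>Density of the orbit\<close>

lemma dense_orbit:
  assumes faithful: "faithful_left_module A N" and simple: "simple_left_module A N"
  shows "\<exists>x \<in> topspace X. X closure_of (action_orbit D \<theta> x) = topspace X"
proof -
  obtain a n where an: "a \<in> carrier A" "n \<in> carrier N" "a \<odot> n \<noteq> \<zero>"
    using simple by (auto simp: simple_left_module_def)
  obtain x where x: "x \<in> topspace X" "\<forall>U. compact_open U \<and> x \<in> U \<longrightarrow> unit_ind U \<odot> n \<noteq> \<zero>"
    using ex_nonzero_germ[OF an] by blast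
  then have "n \<notin> vanishing_on_orbit x"
    using action_orbit_self[OF x(1)] by (auto simp: vanishing_on_orbit_def)
  \<comment> \<open>Simplicity leaves only the zero submodule and the whole module, and the latter
    would contain \<open>n\<close>.\<close>
  then have trivial: "vanishing_on_orbit x = {\<zero>}"
    using simple submodule_vanishing_on_orbit \<open>n \<in> carrier N\<close> by (auto simp: simple_left_module_def)
  have "z \<in> X closure_of (action_orbit D \<theta> x)" if z: "z \<in> topspace X" for z
  proof (rule ccontr)
    assume "z \<notin> X closure_of (action_orbit D \<theta> x)"
    then obtain T where T: "openin X T" "z \<in> T" "T \<inter> action_orbit D \<theta> x = {}"
      using z by (auto simp: in_closure_of)
    \<comment> \<open>The open set \<open>T\<close> is shrunk to a compact open one, since only such
      sets have indicators in the ring.\<close>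
    obtain W where W': "compact_open W" "z \<in> W" "W \<subseteq> T"
      by (rule compact_open_basis[OF T(1,2)])
    then have W: "compact_open W" "z \<in> W" "W \<inter> action_orbit D \<theta> x = {}"
      using T(3) by auto
    then have "unit_ind W \<noteq> \<zero>\<^bsub>A\<^esub>"
      using unit_ind_nonzero by auto
    then obtain m where "m \<in> carrier N" "unit_ind W \<odot> m \<noteq> \<zero>"
      using faithful unit_ind_in_A[OF W(1)] unfolding faithful_left_module_def by blast
    then show False
      using unit_ind_smult_vanishing_on_orbit[OF W(1,3)] trivial by blast
  qed
  then show ?thesis
    by (intro bexI[OF _ x(1)] equalityI closure_of_subset_topspace subsetI)
qed

end

theorem proposition5p5:
  fixes X :: "'x topology"
    and D :: "'s::inverse_semigroup \<Rightarrow> 'x set"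
    and \<theta> :: "'s \<Rightarrow> 'x \<Rightarrow> 'x"
    and E :: "'e topology"
    and p :: "'e \<Rightarrow> 'x"
    and \<alpha> :: "('s \<times> 'x) set \<Rightarrow> 'e \<Rightarrow> 'e"
    and \<O> :: "'x \<Rightarrow> 'e ring"
  assumes "locally_compact_space X" and "Hausdorff_space X" and "zero_dimensional_space X"
    and "inverse_semigroup_action X D \<theta>"
    and "groupoid_sheaf_of_rings (germ_groupoid X D \<theta>) E p \<alpha> \<O>"
    and "left_primitive TYPE('n) (Gamma_c (germ_groupoid X D \<theta>) E \<alpha> \<O>)"
  shows "\<exists>x \<in> topspace X. X closure_of (action_orbit D \<theta> x) = topspace X"
proof -
  obtain N :: "(('s \<times> 'x) set \<Rightarrow> 'e, 'n) module"
    where N: "faithful_left_module (Gamma_c (germ_groupoid X D \<theta>) E \<alpha> \<O>) N"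
      "simple_left_module (Gamma_c (germ_groupoid X D \<theta>) E \<alpha> \<O>) N"
    using assms(6) by (auto simp: left_primitive_def)
  have "left_module (Gamma_c (germ_groupoid X D \<theta>) E \<alpha> \<O>) N"
    using N(1) by (simp add: faithful_left_module_def)
  then interpret germ_sheaf_module X D \<theta> E p \<alpha> \<O> N
    using assms by (intro germ_sheaf_module.intro germ_sheaf_of_rings.intro germ_sheaf_of_rings_axioms.intro)
  show ?thesis
    using dense_orbit N .
qed

end
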